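(* Let $X\subset\Sigma^{\mathbb{Z}}$ be a sofic $\mathbb{Z}$-subshift over a finite alphabet $\Sigma$. Then for every $k\ge 1$ the finiteness problem of $\mathrm{RFA}(X,k)$ is decidable; that is, there is an algorithm which, given a finite set of (words over) elements of $\mathrm{RFA}(X,k)$ presented by local rules, decides whether these elements generate a finite subgroup.
   Context: A $\mathbb{Z}$-subshift $X\subset\Sigma^{\mathbb{Z}}$ is a closed subset invariant under the shift $(\sigma^{m}(x))_i=x_{i-m}$; it is sofic if the set of finite words occurring in its configurations is a regular language. Let $Q=\{1,\dots,k\}$. For finite $F\subset\mathbb{Z}$ let $L_F(X)=\{x|_F:x\in X\}$. $\mathrm{RFA}(X,k)$ (reversible finite-state automata on $X$ with $k$ states, moving head model) is the group, under composition, of all bijections $T:X\times Q\times\mathbb{Z}\to X\times Q\times\mathbb{Z}$ (tape, state, head position) for which there are a finite $F\subset\mathbb{Z}$ and a function (local rule) $f:L_F(X)\times Q\to Q\times\mathbb{Z}$ such that $T(x,q,i)=(x,q',i+m)$, where $(q',m)=f(\sigma^{-i}(x)|_F,q)$, and whose inverse is also of this form. *)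

theory Defs
  imports
    "HOL-Analysis.Function_Topology"
    "HOL-Algebra.Bij"
    "HOL-Algebra.Generated_Groups"
    "HOL-Library.Nat_Bijection"
begin

section \<open>Sofic subshifts\<close>

definition shift :: "int \<Rightarrow> (int \<Rightarrow> 'a) \<Rightarrow> int \<Rightarrow> 'a" where
  "shift m x = (\<lambda>i. x (i - m))"

definition subshift :: "(int \<Rightarrow> 'a) set \<Rightarrow> bool" where
  "subshift X \<longleftrightarrow>
     closedin (product_topology (\<lambda>_. discrete_topology UNIV) UNIV) X \<and>
     (\<forall>m. \<forall>x\<in>X. shift m x \<in> X)"

definition language :: "(int \<Rightarrow> 'a) set \<Rightarrow> 'a list set" where
  "language X = {map x [i..j] | x i j. x \<in> X}"

text \<open>Recognition by a complete deterministic automaton; taking the finite state set \<open>S\<close> in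
  \<^typ>\<open>nat\<close> loses no generality.\<close>

definition regular :: "'a list set \<Rightarrow> bool" where
  "regular L \<longleftrightarrow>
     (\<exists>(S :: nat set) s0 A \<delta>. finite S \<and> s0 \<in> S \<and> A \<subseteq> S \<and> (\<forall>s\<in>S. \<forall>a. \<delta> s a \<in> S) \<and>
        L = {w. foldl \<delta> s0 w \<in> A})"

definition sofic_subshift :: "(int \<Rightarrow> 'a) set \<Rightarrow> bool" where
  "sofic_subshift X \<longleftrightarrow> subshift X \<and> regular (language X)"


section \<open>Reversible finite-state automata, moving head model\<close>

type_synonym 'a config = "(int \<Rightarrow> 'a) \<times> nat \<times> int"

type_synonym 'a local_rule = "(int \<Rightarrow> 'a) \<times> nat \<Rightarrow> nat \<times> int"

definition configs :: "(int \<Rightarrow> 'a) set \<Rightarrow> nat \<Rightarrow> 'a config set" where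
  "configs X k = X \<times> {1..k} \<times> UNIV"

text \<open>A pattern with support \<open>F\<close> is a function on \<^typ>\<open>int\<close> that is \<^const>\<open>undefined\<close>
  outside \<open>F\<close>.\<close>

definition patterns :: "int set \<Rightarrow> (int \<Rightarrow> 'a) set \<Rightarrow> (int \<Rightarrow> 'a) set" where
  "patterns F X = (\<lambda>x. restrict x F) ` X"

definition rule_map ::
    "(int \<Rightarrow> 'a) set \<Rightarrow> nat \<Rightarrow> int set \<Rightarrow> 'a local_rule \<Rightarrow> 'a config \<Rightarrow> 'a config" where
  "rule_map X k F f =
     restrict (\<lambda>(x, q, i). let (q', m) = f (restrict (shift (- i) x) F, q) in (x, q', i + m))
       (configs X k)"

definition has_local_rule :: "(int \<Rightarrow> 'a) set \<Rightarrow> nat \<Rightarrow> ('a config \<Rightarrow> 'a config) \<Rightarrow> bool" where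
  "has_local_rule X k T \<longleftrightarrow>
     (\<exists>F f. finite F \<and> f \<in> patterns F X \<times> {1..k} \<rightarrow> {1..k} \<times> UNIV \<and> T = rule_map X k F f)"

definition RFA_carrier :: "(int \<Rightarrow> 'a) set \<Rightarrow> nat \<Rightarrow> ('a config \<Rightarrow> 'a config) set" where
  "RFA_carrier X k =
     {T \<in> Bij (configs X k).
        has_local_rule X k T \<and>
        has_local_rule X k (restrict (inv_into (configs X k) T) (configs X k))}"

definition RFA :: "(int \<Rightarrow> 'a) set \<Rightarrow> nat \<Rightarrow> ('a config \<Rightarrow> 'a config) monoid" where
  "RFA X k = BijGroup (configs X k) \<lparr>carrier := RFA_carrier X k\<rparr>"

lemma has_local_rule_id: "has_local_rule X k (restrict (\<lambda>c. c) (configs X k))"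
  unfolding has_local_rule_def
proof (intro exI conjI)
  show "restrict (\<lambda>c. c) (configs X k) = rule_map X k {} (\<lambda>(u, q). (q, 0))"
    by (auto simp: rule_map_def fun_eq_iff restrict_def)
qed auto

lemma has_local_rule_compose:
  fixes X :: "(int \<Rightarrow> 'a::finite) set"
  assumes S: "subshift X" and "has_local_rule X k T2" "has_local_rule X k T1"
  shows "has_local_rule X k (compose (configs X k) T2 T1)"
proof -
  obtain F1 f1 where F1: "finite F1" and f1: "f1 \<in> patterns F1 X \<times> {1..k} \<rightarrow> {1..k} \<times> UNIV"
    and T1: "T1 = rule_map X k F1 f1"
    using assms(3) unfolding has_local_rule_def by blast
  obtain F2 f2 where F2: "finite F2" and f2: "f2 \<in> patterns F2 X \<times> {1..k} \<rightarrow> {1..k} \<times> UNIV"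
    and T2: "T2 = rule_map X k F2 f2"
    using assms(2) unfolding has_local_rule_def by blast
  define M where "M = (\<lambda>p. snd (f1 p)) ` (patterns F1 X \<times> {1..k})"
  have "patterns F1 X \<subseteq> PiE F1 (\<lambda>_. UNIV)"
    by (auto simp: patterns_def)
  then have "finite (patterns F1 X)"
    by (rule finite_subset) (simp add: F1 finite_PiE)
  then have M: "finite M"
    by (simp add: M_def)
  define F where "F = F1 \<union> (\<Union>m\<in>M. (\<lambda>j. j + m) ` F2)"
  define f where "f = (\<lambda>(u, q). let (q1, m1) = f1 (restrict u F1, q);
       (q2, m2) = f2 (\<lambda>j\<in>F2. u (j + m1), q1) in (q2, m1 + m2))"
  have sh: "shift m x \<in> X" if "x \<in> X" for x m
    using S that by (auto simp: subshift_def)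
  have step: "\<exists>q1 m1 q2 m2. f1 (restrict x F1, q) = (q1, m1) \<and> q1 \<in> {1..k} \<and>
      (\<lambda>j\<in>F2. restrict x F (j + m1)) = restrict (shift (- m1) x) F2 \<and>
      f2 (restrict (shift (- m1) x) F2, q1) = (q2, m2) \<and> q2 \<in> {1..k} \<and>
      f (restrict x F, q) = (q2, m1 + m2)"
    if x: "x \<in> X" and q: "q \<in> {1..k}" for x q
  proof -
    obtain q1 m1 where e1: "f1 (restrict x F1, q) = (q1, m1)" by fastforce
    have p1: "(restrict x F1, q) \<in> patterns F1 X \<times> {1..k}"
      using x q by (auto simp: patterns_def)
    have q1: "q1 \<in> {1..k}"
      using funcset_mem[OF f1 p1] e1 by auto
    have m1: "m1 \<in> M"
      unfolding M_def using p1 e1 by (metis (lifting) image_eqI snd_conv)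
    obtain q2 m2 where e2: "f2 (restrict (shift (- m1) x) F2, q1) = (q2, m2)" by fastforce
    have q2: "q2 \<in> {1..k}"
      using funcset_mem[OF f2, of "(restrict (shift (- m1) x) F2, q1)"] e2 q1 sh[OF x]
      by (auto simp: patterns_def)
    have r1: "restrict (restrict x F) F1 = restrict x F1"
      by (auto simp: F_def restrict_def fun_eq_iff)
    have r2: "(\<lambda>j\<in>F2. restrict x F (j + m1)) = restrict (shift (- m1) x) F2"
    proof
      fix j
      have "j + m1 \<in> F" if "j \<in> F2"
        unfolding F_def using that m1 by blast
      then show "(\<lambda>j\<in>F2. restrict x F (j + m1)) j = restrict (shift (- m1) x) F2 j"
        by (auto simp: shift_def)
    qed
    have "f (restrict x F, q) = (q2, m1 + m2)"
      by (simp only: f_def split r1 r2 e1 e2 Let_def)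
    then show ?thesis
      using e1 q1 r2 e2 q2 by blast
  qed
  have "finite F"
    using F1 F2 M by (auto simp: F_def)
  moreover have "f \<in> patterns F X \<times> {1..k} \<rightarrow> {1..k} \<times> UNIV"
  proof
    fix p assume "p \<in> patterns F X \<times> {1..k}"
    then obtain x q where "x \<in> X" "q \<in> {1..k}" "p = (restrict x F, q)"
      by (auto simp: patterns_def)
    then show "f p \<in> {1..k} \<times> UNIV"
      using step by fastforce
  qed
  moreover have "compose (configs X k) T2 T1 = rule_map X k F f"
  proof
    fix c :: "'a config"
    obtain x q i where c: "c = (x, q, i)" by (cases c)
    show "compose (configs X k) T2 T1 c = rule_map X k F f c"
    proof (cases "c \<in> configs X k")
      case True
      then have x: "x \<in> X" and q: "q \<in> {1..k}"
        by (auto simp: c configs_def)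
      obtain q1 m1 q2 m2 where *: "f1 (restrict (shift (- i) x) F1, q) = (q1, m1)"
          "q1 \<in> {1..k}" "f2 (restrict (shift (- m1) (shift (- i) x)) F2, q1) = (q2, m2)"
          "f (restrict (shift (- i) x) F, q) = (q2, m1 + m2)"
        using step[OF sh[OF x] q] by blast
      have ss: "shift (- m1) (shift (- i) x) = shift (- (i + m1)) x"
        by (auto simp: shift_def fun_eq_iff algebra_simps)
      have "T1 c = (x, q1, i + m1)"
        using True *(1) by (simp add: T1 rule_map_def c)
      moreover have "T2 (x, q1, i + m1) = (x, q2, i + m1 + m2)"
        using x *(2,3) by (simp add: T2 rule_map_def configs_def ss)
      ultimately show ?thesis
        using True *(4) by (simp add: compose_def rule_map_def c algebra_simps)
    qed (simp add: compose_def rule_map_def)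
  qed
  ultimately show ?thesis
    unfolding has_local_rule_def by blast
qed

lemma subgroup_RFA_carrier:
  fixes X :: "(int \<Rightarrow> 'a::finite) set"
  assumes "subshift X"
  shows "subgroup (RFA_carrier X k) (BijGroup (configs X k))"
proof -
  let ?B = "BijGroup (configs X k)"
  interpret B: group ?B by (rule group_BijGroup)
  have car: "RFA_carrier X k =
      {T \<in> carrier ?B. has_local_rule X k T \<and> has_local_rule X k (inv\<^bsub>?B\<^esub> T)}"
  proof -
    have "carrier ?B = Bij (configs X k)"
      by (simp add: BijGroup_def)
    then show ?thesis
      by (auto simp: RFA_carrier_def inv_BijGroup)
  qed
  have mul: "has_local_rule X k (T \<otimes>\<^bsub>?B\<^esub> T')"
    if "T \<in> carrier ?B" "T' \<in> carrier ?B" "has_local_rule X k T" "has_local_rule X k T'" for T T'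
    using that has_local_rule_compose[OF assms] by (simp add: BijGroup_def)
  show ?thesis
  proof (rule B.subgroupI)
    have "\<one>\<^bsub>?B\<^esub> \<in> RFA_carrier X k"
      using has_local_rule_id[of X k] by (simp add: car) (simp add: BijGroup_def)
    then show "RFA_carrier X k \<noteq> {}" by blast
  qed (auto simp: car mul B.inv_mult_group)
qed

lemma group_RFA:
  fixes X :: "(int \<Rightarrow> 'a::finite) set"
  assumes "subshift X"
  shows "group (RFA X k)"
  unfolding RFA_def
  by (rule subgroup.subgroup_is_group[OF subgroup_RFA_carrier[OF assms] group_BijGroup])


section \<open>Finite presentations of local rules\<close>

text \<open>A table \<open>(Fs, t)\<close> lists the elements of the neighbourhood \<open>F\<close> in some order and the graph
  of the local rule as an association list; a pattern on \<open>F\<close> is the word of its values along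
  \<open>Fs\<close>.\<close>

type_synonym 'a table = "int list \<times> (('a list \<times> nat) \<times> (nat \<times> int)) list"

fun table_wf :: "(int \<Rightarrow> 'a) set \<Rightarrow> nat \<Rightarrow> 'a table \<Rightarrow> bool" where
  "table_wf X k (Fs, t) \<longleftrightarrow>
     distinct Fs \<and>
     dom (map_of t) = {(map x Fs, q) | x q. x \<in> X \<and> q \<in> {1..k}} \<and>
     ran (map_of t) \<subseteq> {1..k} \<times> UNIV"

fun table_map :: "(int \<Rightarrow> 'a) set \<Rightarrow> nat \<Rightarrow> 'a table \<Rightarrow> 'a config \<Rightarrow> 'a config" where
  "table_map X k (Fs, t) = rule_map X k (set Fs) (\<lambda>(u, q). the (map_of t (map u Fs, q)))"

definition presents_RFA_element :: "(int \<Rightarrow> 'a) set \<Rightarrow> nat \<Rightarrow> 'a table \<Rightarrow> bool" where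
  "presents_RFA_element X k p \<longleftrightarrow> table_wf X k p \<and> table_map X k p \<in> carrier (RFA X k)"

definition word_value :: "(int \<Rightarrow> 'a) set \<Rightarrow> nat \<Rightarrow> 'a table list \<Rightarrow> 'a config \<Rightarrow> 'a config" where
  "word_value X k w = foldr (\<lambda>p T. table_map X k p \<otimes>\<^bsub>RFA X k\<^esub> T) w \<one>\<^bsub>RFA X k\<^esub>"

text \<open>\<open>enc\<close> is meant to be an injective numbering of the finite alphabet; any two such
  numberings are computably interchangeable.\<close>

fun encode_entry :: "('a \<Rightarrow> nat) \<Rightarrow> ('a list \<times> nat) \<times> (nat \<times> int) \<Rightarrow> nat" where
  "encode_entry enc ((u, q), (q', m)) =
     prod_encode (prod_encode (list_encode (map enc u), q), prod_encode (q', int_encode m))"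

fun encode_table :: "('a \<Rightarrow> nat) \<Rightarrow> 'a table \<Rightarrow> nat" where
  "encode_table enc (Fs, t) =
     prod_encode (list_encode (map int_encode Fs), list_encode (map (encode_entry enc) t))"

definition encode_words :: "('a \<Rightarrow> nat) \<Rightarrow> 'a table list list \<Rightarrow> nat" where
  "encode_words enc ws = list_encode (map (\<lambda>w. list_encode (map (encode_table enc) w)) ws)"


section \<open>Algorithms: partial recursive functions\<close>

datatype recf =
    Zero
  | Succ
  | Proj nat
  | Comp recf "recf list"
  | Prec recf recf
  | Mu recf

text \<open>\<open>computes f xs y\<close>: the program \<open>f\<close> halts on the argument tuple \<open>xs\<close> with
  value \<open>y\<close>.  The recursion and search variable is the first argument.\<close>

inductive computes :: "recf \<Rightarrow> nat list \<Rightarrow> nat \<Rightarrow> bool" where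
  Zero: "computes Zero xs 0"
| Succ: "computes Succ [n] (Suc n)"
| Proj: "i < length xs \<Longrightarrow> computes (Proj i) xs (xs ! i)"
| Comp: "list_all2 (\<lambda>g y. computes g xs y) gs ys \<Longrightarrow> computes f ys z \<Longrightarrow>
         computes (Comp f gs) xs z"
| Prec_0: "computes f xs y \<Longrightarrow> computes (Prec f g) (0 # xs) y"
| Prec_Suc: "computes (Prec f g) (n # xs) y \<Longrightarrow> computes g (n # y # xs) z \<Longrightarrow>
         computes (Prec f g) (Suc n # xs) z"
| Mu: "computes f (n # xs) 0 \<Longrightarrow> (\<forall>m<n. \<exists>y>0. computes f (m # xs) y) \<Longrightarrow>
         computes (Mu f) xs n"

lemma computes_deterministic: "computes f xs y \<Longrightarrow> computes f xs z \<Longrightarrow> y = z"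
proof (induction arbitrary: z rule: computes.induct)
  case (Zero xs)
  then show ?case by cases simp
next
  case (Succ n)
  then show ?case by cases simp
next
  case (Proj i xs)
  from Proj.prems show ?case by cases simp
next
  case (Prec_0 f xs y g)
  from Prec_0.prems show ?case by cases (use Prec_0.IH in blast)
next
  case (Comp xs gs ys f y)
  from Comp.prems obtain ys' where ys': "list_all2 (\<lambda>g y. computes g xs y) gs ys'"
    and f: "computes f ys' z"
    by cases
  have "ys = ys'"
    using Comp.IH(1) ys' by (auto simp: list_all2_conv_all_nth intro: nth_equalityI)
  with f Comp.IH(2) show ?case by blast
next
  case (Prec_Suc f g n xs y z')
  from Prec_Suc.prems show ?case
    by cases (use Prec_Suc.IH in blast)
next
  case (Mu f n xs)
  from Mu.prems have 0: "computes f (z # xs) 0"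
    and pos: "\<forall>m<z. \<exists>y>0. computes f (m # xs) y"
    by (cases, blast)+
  show ?case
  proof (cases n z rule: linorder_cases)
    case less
    then show ?thesis using pos Mu.IH(1) by fastforce
  next
    case greater
    then show ?thesis using 0 Mu.IH(2) by fastforce
  qed
qed

end

theory Submission
  imports Defs
begin

text \<open>
  The automata in question never change the tape. On a fixed tape \<open>x\<close> the generators define a graph on
  states and head positions, and the group acts along its edges. The generated group is finite if
  and only if the displacement of the head, from position \<open>0\<close>, is bounded uniformly over all tapes,
  states and products of generators. Indeed, each element of the group has bounded displacement
  because its local rule is finite; and if all products have displacement at most \<open>N\<close>, each of them is
  determined by a function on patterns of bounded width (lemmas \<open>bounded_if_finite\<close> and
  \<open>finite_products\<close>). It is enough to look at products without inverses, because a finite submonoid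
  of a group is a subgroup (lemma \<open>generate_subset_products\<close>).

  The point is that a bounded displacement is bounded by a computable number, which is a pumping
  argument. Assume that a trajectory of maximal displacement runs far to the right. For each cut
  that it passes, record three things: which words may follow the left half of the tape, which
  pattern stands around the cut, and which excursions into the left part of the tape are possible,
  as a relation between the points where a trajectory enters the left part and those where it
  leaves it. For a sofic subshift there are finitely many
  possibilities, and their number is an explicit function of the radius of the generators. If two
  cuts agree, the segment between them can be repeated: the new tape is again in the subshift
  (lemma \<open>glue_in_subshift\<close>), and the trajectory can be imitated on it and arrives further to the
  right (lemma \<open>pump\<close>), which contradicts maximality. The left direction follows by reflection.

  Hence the group is infinite if and only if some trajectory exceeds the computed bound. Such a
  trajectory can be chosen of bounded length (lemma \<open>short_run\<close>), so it stays in a window of bounded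
  width. It remains to search through finitely many words of the language, states and sequences of
  generators (lemma \<open>escapes_iff\<close>). That this search is carried out by a program is shown by closure
  properties of computable functions between encoded types, in the style of a small functional
  programming language.
\<close>

section \<open>Computable functions between encoded types\<close>

text \<open>Programs of a fixed arity serve only to build pairing and its inverse. Once these are available,
  every computable function is treated as a unary one on codes.\<close>

definition recfun :: "nat \<Rightarrow> (nat list \<Rightarrow> nat) \<Rightarrow> bool" where
  "recfun n f \<longleftrightarrow> (\<exists>p. \<forall>xs. length xs = n \<longrightarrow> computes p xs (f xs))"

lemma recfun_cong: "recfun n f \<Longrightarrow> (\<And>xs. length xs = n \<Longrightarrow> f xs = g xs) \<Longrightarrow> recfun n g"
  unfolding recfun_def by metis

lemma recfun_nth: "i < n \<Longrightarrow> recfun n (\<lambda>xs. xs ! i)"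
  unfolding recfun_def by (blast intro: computes.Proj)

lemma recfun_comp1:
  assumes "recfun 1 (\<lambda>ys. f (ys ! 0))" "recfun n g"
  shows "recfun n (\<lambda>xs. f (g xs))"
proof -
  obtain p where p: "\<And>xs. length xs = 1 \<Longrightarrow> computes p xs (f (xs ! 0))"
    using assms(1) unfolding recfun_def by blast
  obtain q where q: "\<And>xs. length xs = n \<Longrightarrow> computes q xs (g xs)"
    using assms(2) unfolding recfun_def by blast
  have "computes (Comp p [q]) xs (f (g xs))" if "length xs = n" for xs
    by (rule computes.Comp[of xs _ "[g xs]"]) (use q[OF that] p[of "[g xs]"] in auto)
  then show ?thesis unfolding recfun_def by blast
qed

lemma recfun_comp2:
  assumes "recfun 2 (\<lambda>ys. f (ys ! 0) (ys ! 1))" "recfun n g" "recfun n h"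
  shows "recfun n (\<lambda>xs. f (g xs) (h xs))"
proof -
  obtain p where p: "\<And>xs. length xs = 2 \<Longrightarrow> computes p xs (f (xs ! 0) (xs ! 1))"
    using assms(1) unfolding recfun_def by blast
  obtain q where q: "\<And>xs. length xs = n \<Longrightarrow> computes q xs (g xs)"
    using assms(2) unfolding recfun_def by blast
  obtain r where r: "\<And>xs. length xs = n \<Longrightarrow> computes r xs (h xs)"
    using assms(3) unfolding recfun_def by blast
  have "computes (Comp p [q, r]) xs (f (g xs) (h xs))" if "length xs = n" for xs
    by (rule computes.Comp[of xs _ "[g xs, h xs]"])
      (use q[OF that] r[OF that] p[of "[g xs, h xs]"] in auto)
  then show ?thesis unfolding recfun_def by blast
qed

lemma recfun_Suc: "recfun n f \<Longrightarrow> recfun n (\<lambda>xs. Suc (f xs))"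
proof (erule recfun_comp1[rotated])
  show "recfun 1 (\<lambda>ys. Suc (ys ! 0))"
    unfolding recfun_def
    by (rule exI[of _ Succ]) (auto simp: length_Suc_conv intro: computes.Succ)
qed

lemma recfun_const: "recfun n (\<lambda>_. c)"
proof (induction c)
  case 0
  then show ?case unfolding recfun_def by (blast intro: computes.Zero)
qed (rule recfun_Suc)

lemma recfun_rec_nat:
  assumes "recfun n f" "recfun (Suc (Suc n)) g"
  shows "recfun (Suc n) (\<lambda>xs. rec_nat (f (tl xs)) (\<lambda>m y. g (m # y # tl xs)) (hd xs))"
proof -
  obtain p where p: "\<And>xs. length xs = n \<Longrightarrow> computes p xs (f xs)"
    using assms(1) unfolding recfun_def by blast
  obtain q where q: "\<And>xs. length xs = Suc (Suc n) \<Longrightarrow> computes q xs (g xs)"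
    using assms(2) unfolding recfun_def by blast
  have "computes (Prec p q) (m # xs) (rec_nat (f xs) (\<lambda>m y. g (m # y # xs)) m)"
    if "length xs = n" for m xs
    using that by (induction m) (auto intro!: computes.Prec_0 p computes.Prec_Suc q)
  then show ?thesis
    unfolding recfun_def by (intro exI[of _ "Prec p q"]) (auto simp: length_Suc_conv)
qed

lemma recfun_rec_nat_1:
  assumes "recfun 2 (\<lambda>xs. g (xs ! 0) (xs ! 1))"
  shows "recfun 1 (\<lambda>xs. rec_nat c g (xs ! 0))"
proof -
  have "recfun (Suc (Suc 0)) (\<lambda>xs. g (xs ! 0) (xs ! 1))"
    using assms by (simp add: numeral_2_eq_2)
  from recfun_rec_nat[OF recfun_const this]
  have "recfun (Suc 0) (\<lambda>xs. rec_nat c (\<lambda>m y. g m y) (hd xs))"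
    by simp
  then have "recfun 1 (\<lambda>xs. rec_nat c g (hd xs))" by simp
  then show ?thesis
    by (rule recfun_cong) (auto simp: length_Suc_conv)
qed

lemma recfun_rec_nat_2:
  assumes "recfun 2 (\<lambda>xs. g (xs ! 0) (xs ! 1))"
  shows "recfun 2 (\<lambda>xs. rec_nat (xs ! 1) g (xs ! 0))"
proof -
  have "recfun (Suc (Suc (Suc 0))) (\<lambda>xs. g (xs ! 0) (xs ! 1))"
    by (rule recfun_comp2[OF assms]) (auto intro: recfun_nth)
  from recfun_rec_nat[OF recfun_nth[of 0 "Suc 0"] this]
  have "recfun (Suc (Suc 0)) (\<lambda>xs. rec_nat (tl xs ! 0) (\<lambda>m y. g m y) (hd xs))"
    by simp
  then have "recfun 2 (\<lambda>xs. rec_nat (tl xs ! 0) g (hd xs))" by (simp add: numeral_2_eq_2)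
  then show ?thesis
    by (rule recfun_cong) (auto simp: length_Suc_conv numeral_2_eq_2)
qed

lemma recfun_Least:
  assumes "recfun (Suc n) f" and ex: "\<And>xs. length xs = n \<Longrightarrow> \<exists>m. f (m # xs) = 0"
  shows "recfun n (\<lambda>xs. LEAST m. f (m # xs) = 0)"
proof -
  obtain p where p: "\<And>xs. length xs = Suc n \<Longrightarrow> computes p xs (f xs)"
    using assms(1) unfolding recfun_def by blast
  have "computes (Mu p) xs (LEAST m. f (m # xs) = 0)" if l: "length xs = n" for xs
  proof (rule computes.Mu)
    show "computes p ((LEAST m. f (m # xs) = 0) # xs) 0"
      using p[of "(LEAST m. f (m # xs) = 0) # xs"] LeastI_ex[OF ex[OF l]] l by simp
    show "\<forall>m<LEAST m. f (m # xs) = 0. \<exists>y>0. computes p (m # xs) y"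
    proof (intro allI impI)
      fix m assume "m < (LEAST m. f (m # xs) = 0)"
      then have "0 < f (m # xs)" using not_less_Least by blast
      then show "\<exists>y>0. computes p (m # xs) y" using p[of "m # xs"] l by auto
    qed
  qed
  then show ?thesis unfolding recfun_def by blast
qed

lemma recfun_add: "recfun n f \<Longrightarrow> recfun n g \<Longrightarrow> recfun n (\<lambda>xs. f xs + g xs)"
proof (rule recfun_comp2[of "(+)"])
  have "rec_nat y (\<lambda>m y. Suc y) x = x + y" for x y :: nat
    by (induction x) auto
  moreover have "recfun 2 (\<lambda>ys. rec_nat (ys ! 1) (\<lambda>m y. Suc y) (ys ! 0))"
    by (intro recfun_rec_nat_2 recfun_Suc recfun_nth) simp
  ultimately show "recfun 2 (\<lambda>ys. ys ! 0 + ys ! 1)" by simp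
qed

lemma recfun_pred: "recfun n f \<Longrightarrow> recfun n (\<lambda>xs. f xs - 1)"
proof (erule recfun_comp1[of "\<lambda>x. x - 1", rotated])
  have "rec_nat 0 (\<lambda>m y. m) x = x - 1" for x :: nat
    by (cases x) auto
  moreover have "recfun 1 (\<lambda>ys. rec_nat 0 (\<lambda>m y. m) (ys ! 0))"
    by (intro recfun_rec_nat_1 recfun_nth) simp
  ultimately show "recfun 1 (\<lambda>ys. ys ! 0 - 1)" by simp
qed

lemma recfun_diff: "recfun n f \<Longrightarrow> recfun n g \<Longrightarrow> recfun n (\<lambda>xs. f xs - g xs)"
proof (rule recfun_comp2[of "\<lambda>x y. y - x", rotated 2])
  have "rec_nat y (\<lambda>m y. y - 1) x = y - x" for x y :: nat
    by (induction x) auto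
  moreover have "recfun 2 (\<lambda>ys. rec_nat (ys ! 1) (\<lambda>m y. y - 1) (ys ! 0))"
    by (intro recfun_rec_nat_2 recfun_pred recfun_nth) simp
  ultimately show "recfun 2 (\<lambda>ys. ys ! 1 - ys ! 0)" by simp
qed

lemma recfun_triangle: "recfun n f \<Longrightarrow> recfun n (\<lambda>xs. triangle (f xs))"
proof (erule recfun_comp1[of triangle, rotated])
  have "rec_nat 0 (\<lambda>m y. y + Suc m) x = triangle x" for x :: nat
    by (induction x) auto
  moreover have "recfun 1 (\<lambda>ys. rec_nat 0 (\<lambda>m y. y + Suc m) (ys ! 0))"
    by (intro recfun_rec_nat_1 recfun_add recfun_Suc recfun_nth) simp_all
  ultimately show "recfun 1 (\<lambda>ys. triangle (ys ! 0))" by simp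
qed

lemma recfun_prod_encode:
  "recfun n f \<Longrightarrow> recfun n g \<Longrightarrow> recfun n (\<lambda>xs. prod_encode (f xs, g xs))"
  unfolding prod_encode_def by (simp add: recfun_add recfun_triangle)

lemma triangle_mono: "m \<le> n \<Longrightarrow> triangle m \<le> triangle n"
  by (induction rule: dec_induct) auto

text \<open>Cantor pairing is inverted by search: \<open>s\<close> is the diagonal on which \<open>n\<close> lies, and the distance of
  \<open>n\<close> from the start of that diagonal is the first component.\<close>

lemma prod_decode_Least:
  fixes n :: nat
  defines "s \<equiv> LEAST s. Suc n - triangle (Suc s) = 0"
  shows "prod_decode n = (n - triangle s, s - (n - triangle s))"
proof -
  obtain a b where ab: "prod_decode n = (a, b)" by fastforce
  then have n: "n = triangle (a + b) + a"
    using prod_decode_inverse[of n] by (simp add: prod_encode_def)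
  have "s = a + b"
    unfolding s_def
  proof (rule Least_equality)
    show "Suc n - triangle (Suc (a + b)) = 0" using n by simp
    fix y assume y: "Suc n - triangle (Suc y) = 0"
    show "a + b \<le> y"
    proof (rule ccontr)
      assume "\<not> a + b \<le> y"
      then have "Suc y \<le> a + b" by simp
      from triangle_mono[OF this] y n show False by simp
    qed
  qed
  then show ?thesis using ab n by simp
qed

lemma recfun_prod_decode_triangle:
  "recfun n f \<Longrightarrow> recfun n (\<lambda>xs. LEAST s. Suc (f xs) - triangle (Suc s) = 0)"
proof (erule recfun_comp1[of "\<lambda>n. LEAST s. Suc n - triangle (Suc s) = 0", rotated])
  have ex: "\<exists>m. Suc x - triangle (Suc m) = 0" for x :: nat
    by (rule exI[of _ x]) simp
  have "recfun (Suc (Suc 0)) (\<lambda>ys. Suc (ys ! 1) - triangle (Suc (ys ! 0)))"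
    by (intro recfun_diff recfun_triangle recfun_Suc recfun_nth) simp_all
  from recfun_Least[OF this]
  have "recfun (Suc 0) (\<lambda>xs. LEAST m. Suc ((m # xs) ! 1) - triangle (Suc ((m # xs) ! 0)) = 0)"
    using ex by simp
  then show "recfun 1 (\<lambda>ys. LEAST s. Suc (ys ! 0) - triangle (Suc s) = 0)" by simp
qed

lemma recfun_fst_prod_decode: "recfun n f \<Longrightarrow> recfun n (\<lambda>xs. fst (prod_decode (f xs)))"
  by (simp only: prod_decode_Least fst_conv)
    (intro recfun_diff recfun_triangle recfun_prod_decode_triangle)

lemma recfun_snd_prod_decode: "recfun n f \<Longrightarrow> recfun n (\<lambda>xs. snd (prod_decode (f xs)))"
  by (simp only: prod_decode_Least snd_conv)
    (intro recfun_diff recfun_triangle recfun_prod_decode_triangle)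


text \<open>The instances below agree with the encodings that \<^const>\<open>encode_words\<close> is made of. Programs can
  therefore be written as ordinary functions on pairs, lists and integers, and only the letters of
  the alphabet have to be replaced by numbers.\<close>

class encodable =
  fixes encode :: "'a \<Rightarrow> nat"
  assumes inj_encode: "inj encode"

lemma encode_eq_iff [simp]: "encode x = encode y \<longleftrightarrow> x = y"
  using inj_encode by (auto dest: injD)

instantiation nat :: encodable
begin
definition encode_nat :: "nat \<Rightarrow> nat" where [simp]: "encode_nat n = n"
instance by standard (auto simp: inj_def)
end

instantiation bool :: encodable
begin
definition encode_bool :: "bool \<Rightarrow> nat" where [simp]: "encode_bool b = (if b then 1 else 0)"
instance by standard (auto simp: inj_def)
end

instantiation int :: encodable
begin
definition encode_int :: "int \<Rightarrow> nat" where [simp]: "encode_int i = int_encode i"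
instance by standard (simp add: inj_def int_encode_eq)
end

instantiation prod :: (encodable, encodable) encodable
begin
definition encode_prod :: "'a \<times> 'b \<Rightarrow> nat" where
  [simp]: "encode_prod z = prod_encode (encode (fst z), encode (snd z))"
instance by standard (auto simp: inj_def prod_eq_iff)
end

instantiation list :: (encodable) encodable
begin
definition encode_list :: "'a list \<Rightarrow> nat" where
  "encode_list xs = list_encode (map encode xs)"
instance
proof
  have "inj_on (map (encode :: 'a \<Rightarrow> nat)) UNIV"
    using inj_encode by (simp add: inj_mapI)
  then show "inj (encode :: 'a list \<Rightarrow> nat)"
    by (auto simp: encode_list_def inj_def list_encode_eq)
qed
end

lemma encode_list_simps [simp]:
  "encode [] = 0"
  "encode (x # xs) = Suc (prod_encode (encode x, encode xs))"
  by (simp_all add: encode_list_def)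

definition computable :: "('a::encodable \<Rightarrow> 'b::encodable) \<Rightarrow> bool" where
  "computable f \<longleftrightarrow> (\<exists>p. \<forall>x. computes p [encode x] (encode (f x)))"

lemma computable_encode_iff: "computable (\<lambda>x. encode (f x)) \<longleftrightarrow> computable f"
  by (simp add: computable_def)

lemma computable_recfun:
  assumes "recfun 1 (\<lambda>xs. h (xs ! 0))" "computable g" "\<And>x. encode (f x) = h (encode (g x))"
  shows "computable f"
proof -
  obtain p where p: "\<And>xs. length xs = 1 \<Longrightarrow> computes p xs (h (xs ! 0))"
    using assms(1) unfolding recfun_def by blast
  obtain q where q: "\<And>x. computes q [encode x] (encode (g x))"
    using assms(2) unfolding computable_def by blast
  have "computes (Comp p [q]) [encode x] (encode (f x))" for x
    by (rule computes.Comp[of _ _ "[encode (g x)]"])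
      (use q[of x] p[of "[encode (g x)]"] assms(3) in auto)
  then show ?thesis unfolding computable_def by blast
qed

lemma computable_recfun2:
  assumes "recfun 2 (\<lambda>xs. h (xs ! 0) (xs ! 1))" "computable g1" "computable g2"
    "\<And>x. encode (f x) = h (encode (g1 x)) (encode (g2 x))"
  shows "computable f"
proof -
  obtain p where p: "\<And>xs. length xs = 2 \<Longrightarrow> computes p xs (h (xs ! 0) (xs ! 1))"
    using assms(1) unfolding recfun_def by blast
  obtain q where q: "\<And>x. computes q [encode x] (encode (g1 x))"
    using assms(2) unfolding computable_def by blast
  obtain r where r: "\<And>x. computes r [encode x] (encode (g2 x))"
    using assms(3) unfolding computable_def by blast
  have "computes (Comp p [q, r]) [encode x] (encode (f x))" for x
    by (rule computes.Comp[of _ _ "[encode (g1 x), encode (g2 x)]"])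
      (use q[of x] r[of x] p[of "[encode (g1 x), encode (g2 x)]"] assms(4) in auto)
  then show ?thesis unfolding computable_def by blast
qed

named_theorems computable_intros

lemma computable_id [computable_intros]: "computable (\<lambda>x::'a::encodable. x)"
proof -
  have "computes (Proj 0) [encode x] (encode x)" for x :: 'a
    using computes.Proj[of 0 "[encode x]"] by simp
  then show ?thesis unfolding computable_def by blast
qed

lemma computable_const [computable_intros]: "computable (\<lambda>_. c)"
proof -
  obtain p where "\<And>xs. length xs = 1 \<Longrightarrow> computes p xs (encode c)"
    using recfun_const[of 1 "encode c"] unfolding recfun_def by blast
  then have "computes p [encode x] (encode c)" for x by simp
  then show ?thesis unfolding computable_def by blast
qed

lemma computable_compose: "computable g \<Longrightarrow> computable f \<Longrightarrow> computable (\<lambda>x. g (f x))"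
proof -
  assume "computable g" "computable f"
  then obtain p q where "\<And>x. computes p [encode x] (encode (g x))"
      "\<And>x. computes q [encode x] (encode (f x))"
    unfolding computable_def by blast
  then have "computes (Comp p [q]) [encode x] (encode (g (f x)))" for x
    by (intro computes.Comp[of _ _ "[encode (f x)]"]) auto
  then show ?thesis unfolding computable_def by blast
qed

lemma computable_Pair [computable_intros]:
  "computable f \<Longrightarrow> computable g \<Longrightarrow> computable (\<lambda>x. (f x, g x))"
  by (rule computable_recfun2[of "\<lambda>x y. prod_encode (x, y)" f g])
    (auto intro!: recfun_prod_encode recfun_nth)

lemma computable_fst [computable_intros]: "computable f \<Longrightarrow> computable (\<lambda>x. fst (f x))"
  by (rule computable_recfun[where h = "\<lambda>x. fst (prod_decode x)"])
    (auto intro!: recfun_fst_prod_decode recfun_nth)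

lemma computable_snd [computable_intros]: "computable f \<Longrightarrow> computable (\<lambda>x. snd (f x))"
  by (rule computable_recfun[where h = "\<lambda>x. snd (prod_decode x)"])
    (auto intro!: recfun_snd_prod_decode recfun_nth)

lemma computable_encode [computable_intros]: "computable f \<Longrightarrow> computable (\<lambda>x. encode (f x))"
  by (simp add: computable_encode_iff)

lemma computable_list_decode [computable_intros]:
  "computable f \<Longrightarrow> computable (\<lambda>x. list_decode (f x))"
proof (rule computable_encode_iff[THEN iffD1])
  have "map encode ns = ns" for ns :: "nat list" by (simp add: map_idI)
  then show "computable f \<Longrightarrow> computable (\<lambda>x. encode (list_decode (f x)))"
    by (simp add: encode_list_def)
qed

lemma computable_prod_decode [computable_intros]:
  "computable f \<Longrightarrow> computable (\<lambda>x. prod_decode (f x))"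
  by (rule computable_encode_iff[THEN iffD1]) simp

lemma computable_add [computable_intros]:
  "computable f \<Longrightarrow> computable g \<Longrightarrow> computable (\<lambda>x. f x + g x :: nat)"
  by (rule computable_recfun2[of "(+)" f g]) (auto intro!: recfun_add recfun_nth)

lemma computable_diff [computable_intros]:
  "computable f \<Longrightarrow> computable g \<Longrightarrow> computable (\<lambda>x. f x - g x :: nat)"
  by (rule computable_recfun2[of "(-)" f g]) (auto intro!: recfun_diff recfun_nth)

lemma computable_Suc [computable_intros]: "computable f \<Longrightarrow> computable (\<lambda>x. Suc (f x))"
  by (rule computable_recfun[where h = Suc]) (auto intro!: recfun_Suc recfun_nth)

text \<open>The variables bound by a step function become further components of its input, which explains the
  projections in the premise. All rules for operators with bound variables have this form, so that
  resolution with \<open>computable_intros\<close> follows the syntax of a program. A subprogram that is used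
  under such a binder is composed with the projection to the outer variables.\<close>

lemma computable_rec_nat [computable_intros]:
  assumes a: "computable a"
    and g: "computable (\<lambda>z. g (fst z) (fst (snd z)) (snd (snd z)))"
    and b: "computable b"
  shows "computable (\<lambda>x. rec_nat (a x) (\<lambda>m y. g x m y) (b x))"
proof -
  obtain p where p: "\<And>x. computes p [encode x] (encode (a x))"
    using a unfolding computable_def by blast
  obtain q where q: "\<And>z. computes q [encode z] (encode (g (fst z) (fst (snd z)) (snd (snd z))))"
    using g unfolding computable_def by blast
  obtain r where r: "\<And>x. computes r [encode x] (encode (b x))"
    using b unfolding computable_def by blast
  obtain t where t: "\<And>xs. length xs = 3 \<Longrightarrow>
      computes t xs (prod_encode (xs ! 2, prod_encode (xs ! 0, xs ! 1)))"
  proof -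
    have "recfun 3 (\<lambda>xs. prod_encode (xs ! 2, prod_encode (xs ! 0, xs ! 1)))"
      by (intro recfun_prod_encode recfun_nth) simp_all
    then show thesis using that unfolding recfun_def by blast
  qed
  have step: "computes (Comp q [t]) [m, encode y, encode x] (encode (g x m y))" for m y x
    using t[of "[m, encode y, encode x]"] q[of "(x, m, y)"]
    by (intro computes.Comp[of _ _ "[encode (x, m, y)]"]) (auto simp: numeral_2_eq_2)
  have "computes (Prec p (Comp q [t])) [m, encode x] (encode (rec_nat (a x) (\<lambda>m y. g x m y) m))" for m x
    by (induction m) (auto intro!: computes.Prec_0 p intro: computes.Prec_Suc step)
  then have "computes (Comp (Prec p (Comp q [t])) [r, Proj 0]) [encode x]
      (encode (rec_nat (a x) (\<lambda>m y. g x m y) (b x)))" for x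
    using r[of x] computes.Proj[of 0 "[encode x]"]
    by (intro computes.Comp[of _ _ "[b x, encode x]"]) auto
  then show ?thesis unfolding computable_def by blast
qed

lemma computable_If [computable_intros]:
  assumes "computable b" "computable f" "computable g"
  shows "computable (\<lambda>x. if b x then f x else g x)"
proof -
  have "computable (\<lambda>x. rec_nat (encode (g x)) (\<lambda>_ _. encode (f x)) (encode (b x)))"
    by (intro computable_intros assms computable_compose[OF assms(2), of fst])
  moreover have "rec_nat (encode (g x)) (\<lambda>_ _. encode (f x)) (encode (b x)) =
      encode (if b x then f x else g x)" for x
    by simp
  ultimately show ?thesis by (simp only: computable_encode_iff)
qed

lemma computable_less_eq [computable_intros]:
  "computable f \<Longrightarrow> computable g \<Longrightarrow> computable (\<lambda>x. f x \<le> (g x :: nat))"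
proof -
  assume "computable f" "computable g"
  then have "computable (\<lambda>x. rec_nat (1::nat) (\<lambda>_ _. 0) (f x - g x))"
    by (intro computable_intros)
  moreover have "rec_nat (1::nat) (\<lambda>_ _. 0) (f x - g x) = encode (f x \<le> g x)" for x
    by (cases "f x - g x") auto
  ultimately show ?thesis by (simp only: computable_encode_iff)
qed

lemma computable_conj [computable_intros]:
  "computable f \<Longrightarrow> computable g \<Longrightarrow> computable (\<lambda>x. f x \<and> g x)"
proof -
  assume "computable f" "computable g"
  then have "computable (\<lambda>x. if f x then g x else False)" by (intro computable_intros)
  moreover have "(\<lambda>x. if f x then g x else False) = (\<lambda>x. f x \<and> g x)" by auto
  ultimately show ?thesis by simp
qed

lemma computable_disj [computable_intros]:
  "computable f \<Longrightarrow> computable g \<Longrightarrow> computable (\<lambda>x. f x \<or> g x)"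
proof -
  assume "computable f" "computable g"
  then have "computable (\<lambda>x. if f x then True else g x)" by (intro computable_intros)
  moreover have "(\<lambda>x. if f x then True else g x) = (\<lambda>x. f x \<or> g x)" by auto
  ultimately show ?thesis by simp
qed

lemma computable_less [computable_intros]:
  "computable f \<Longrightarrow> computable g \<Longrightarrow> computable (\<lambda>x. f x < (g x :: nat))"
  unfolding Suc_le_eq[symmetric] by (intro computable_intros)

lemma computable_eq [computable_intros]:
  "computable f \<Longrightarrow> computable g \<Longrightarrow> computable (\<lambda>x. f x = g x)"
proof -
  assume "computable f" "computable g"
  then have "computable (\<lambda>x. encode (f x) \<le> encode (g x) \<and> encode (g x) \<le> encode (f x))"
    by (intro computable_intros)
  then show ?thesis by (simp flip: eq_iff)
qed

lemma computable_bex_less [computable_intros]: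
  fixes b :: "'a::encodable \<Rightarrow> nat"
  assumes "computable (\<lambda>z. P (fst z) (snd z))" "computable b"
  shows "computable (\<lambda>x. \<exists>n<b x. P x n)"
proof -
  have "computable (\<lambda>x. rec_nat False (\<lambda>m y. y \<or> P x m) (b x))"
    by (intro computable_intros assms(2)
        computable_compose[OF assms(1), of "\<lambda>z. (fst z, fst (snd z))", simplified])
  moreover have "rec_nat False (\<lambda>m y. y \<or> P x m) b \<longleftrightarrow> (\<exists>n<b. P x n)" for x b
    by (induction b) (auto simp: less_Suc_eq)
  ultimately show ?thesis by simp
qed

lemma computable_mult [computable_intros]:
  "computable f \<Longrightarrow> computable g \<Longrightarrow> computable (\<lambda>x. f x * g x :: nat)"
proof -
  assume f: "computable f" and g: "computable g"
  have "computable (\<lambda>x. rec_nat 0 (\<lambda>_ y. y + g x) (f x))"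
    by (intro computable_intros f computable_compose[OF g, of fst])
  moreover have "rec_nat 0 (\<lambda>_ y. y + b) a = a * b" for a b :: nat
    by (induction a) auto
  ultimately show ?thesis by simp
qed

lemma computable_power [computable_intros]:
  "computable f \<Longrightarrow> computable g \<Longrightarrow> computable (\<lambda>x. f x ^ g x :: nat)"
proof -
  assume f: "computable f" and g: "computable g"
  have "computable (\<lambda>x. rec_nat 1 (\<lambda>_ y. f x * y) (g x))"
    by (intro computable_intros g computable_compose[OF f, of fst])
  moreover have "rec_nat 1 (\<lambda>_ y. b * y) a = b ^ a" for a b :: nat
    by (induction a) auto
  ultimately show ?thesis by simp
qed

lemma computable_Cons [computable_intros]:
  "computable f \<Longrightarrow> computable g \<Longrightarrow> computable (\<lambda>x. f x # g x)"
  by (rule computable_recfun2[of "\<lambda>x y. Suc (prod_encode (x, y))" f g])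
    (auto intro!: recfun_Suc recfun_prod_encode recfun_nth)

lemma computable_tl [computable_intros]: "computable f \<Longrightarrow> computable (\<lambda>x. tl (f x))"
proof (rule computable_recfun[OF recfun_snd_prod_decode[OF recfun_pred[OF recfun_nth]]])
  have "prod_decode 0 = (0, 0)"
    by (simp add: prod_decode_def prod_decode_aux.simps)
  then show "encode (tl (f x)) = snd (prod_decode (encode (f x) - 1))" for x
    by (cases "f x") auto
qed simp_all

text \<open>The code of the fixed value \<^term>\<open>hd []\<close> is a constant of the program.\<close>

lemma computable_hd [computable_intros]:
  fixes f :: "'a::encodable \<Rightarrow> 'b::encodable list"
  assumes f: "computable f"
  shows "computable (\<lambda>x. hd (f x))"
proof -
  have "computable (\<lambda>x. if f x = [] then encode (hd [] :: 'b) else fst (prod_decode (encode (f x) - 1)))"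
    by (intro computable_intros f)
  moreover have "(if f x = [] then encode (hd [] :: 'b) else fst (prod_decode (encode (f x) - 1))) =
      encode (hd (f x))" for x
    by (cases "f x") auto
  ultimately show ?thesis by (simp only: computable_encode_iff)
qed

lemma length_le_encode: "length xs \<le> encode xs"
  by (induction xs) (auto intro: order_trans[OF _ le_prod_encode_2])

text \<open>The code of a list is at least its length. Hence primitive recursion up to the code, on pairs of
  an accumulator and a remaining list, performs the whole fold; it idles once the list is used up.\<close>

lemma computable_foldl [computable_intros]:
  assumes g: "computable (\<lambda>z. g (fst z) (fst (snd z)) (snd (snd z)))"
    and a: "computable a" and l: "computable l"
  shows "computable (\<lambda>x. foldl (g x) (a x) (l x))"
proof -
  define step where "step = (\<lambda>x st. if snd st = [] then st else (g x (fst st) (hd (snd st)), tl (snd st)))"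
  have "computable (\<lambda>x. fst (rec_nat (a x, l x) (\<lambda>_ st. step x st) (encode (l x))))"
    unfolding step_def
    by (intro computable_intros a l
        computable_compose[OF g, of "\<lambda>z. (fst z, fst (snd (snd z)), hd (snd (snd (snd z))))", simplified])
  moreover have "rec_nat (s, xs) (\<lambda>_ st. step x st) n = (foldl (g x) s (take n xs), drop n xs)" for x s xs n
    by (induction n)
      (auto simp: step_def take_Suc_conv_app_nth hd_drop_conv_nth drop_Suc tl_drop)
  ultimately show ?thesis by (simp add: length_le_encode)
qed

lemma computable_rev [computable_intros]: "computable f \<Longrightarrow> computable (\<lambda>x. rev (f x))"
proof -
  assume "computable f"
  then have "computable (\<lambda>x. foldl (\<lambda>ys y. y # ys) [] (f x))"
    by (intro computable_intros)
  moreover have "foldl (\<lambda>ys y. y # ys) zs xs = rev xs @ zs" for xs zs :: "'b list"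
    by (induction xs arbitrary: zs) auto
  ultimately show ?thesis by simp
qed

lemma computable_foldr [computable_intros]:
  assumes g: "computable (\<lambda>z. g (fst z) (fst (snd z)) (snd (snd z)))"
    and a: "computable a" and l: "computable l"
  shows "computable (\<lambda>x. foldr (g x) (l x) (a x))"
  unfolding foldr_conv_foldl
  by (intro computable_intros a l
      computable_compose[OF g, of "\<lambda>z. (fst z, snd (snd z), fst (snd z))", simplified])

lemma computable_map [computable_intros]:
  assumes g: "computable (\<lambda>z. g (fst z) (snd z))" and l: "computable l"
  shows "computable (\<lambda>x. map (g x) (l x))"
proof -
  have "computable (\<lambda>x. foldr (\<lambda>y ys. g x y # ys) (l x) [])"
    by (intro computable_intros l
        computable_compose[OF g, of "\<lambda>z. (fst z, fst (snd z))", simplified])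
  moreover have "foldr (\<lambda>y ys. g x y # ys) xs [] = map (g x) xs" for x xs
    by (induction xs) auto
  ultimately show ?thesis by simp
qed

lemma computable_length [computable_intros]: "computable f \<Longrightarrow> computable (\<lambda>x. length (f x))"
proof -
  assume "computable f"
  then have "computable (\<lambda>x. foldr (\<lambda>_ n. Suc n) (f x) 0)"
    by (intro computable_intros)
  moreover have "foldr (\<lambda>_ n. Suc n) xs 0 = length xs" for xs :: "'b list"
    by (induction xs) auto
  ultimately show ?thesis by simp
qed

lemma computable_drop [computable_intros]:
  "computable f \<Longrightarrow> computable g \<Longrightarrow> computable (\<lambda>x. drop (f x) (g x))"
proof -
  assume "computable f" "computable g"
  then have "computable (\<lambda>x. rec_nat (g x) (\<lambda>_ ys. tl ys) (f x))"
    by (intro computable_intros)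
  moreover have "rec_nat xs (\<lambda>_ ys. tl ys) n = drop n xs" for n and xs :: "'b list"
    by (induction n) (auto simp: drop_Suc tl_drop)
  ultimately show ?thesis by simp
qed

text \<open>A function given by a finite table is built into the program; this makes the transition function
  of a finite automaton computable, whatever it is.\<close>

lemma finite_imp_computable_on:
  fixes f :: "'a::encodable \<Rightarrow> 'b::encodable"
  assumes "finite A"
  shows "\<exists>g. computable g \<and> (\<forall>x\<in>A. g x = f x)"
  using assms
proof induction
  case empty
  show ?case by (intro exI[of _ "\<lambda>_. undefined"] conjI computable_intros) simp
next
  case (insert a A)
  then obtain g where g: "computable g" "\<forall>x\<in>A. g x = f x" by blast
  have "computable (\<lambda>x. if x = a then f a else g x)"
    by (intro computable_intros g)
  then show ?case using g(2) by (intro exI conjI) auto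
qed


section \<open>Pumping local dynamics\<close>

text \<open>The segment of \<open>x\<close> between the cuts \<open>j\<close> and \<open>j'\<close> is repeated once: nothing changes to the left of
  \<open>j'\<close>, and what used to start at \<open>j\<close> now starts at \<open>j'\<close>.\<close>

definition glue :: "int \<Rightarrow> int \<Rightarrow> (int \<Rightarrow> 'a) \<Rightarrow> int \<Rightarrow> 'a" where
  "glue j j' x = (\<lambda>i. if i < j' then x i else x (i - (j' - j)))"

text \<open>The number of types of cuts, for \<open>s\<close> classes of left contexts, \<open>n\<close> letters, \<open>k\<close> states and radius
  \<open>r\<close>: a class, a pattern on \<open>2 * r\<close> cells, and a relation between the \<open>Suc (k * r)\<close> entries and the
  \<open>k * r\<close> exits defined below.\<close>

definition displacement_bound :: "nat \<Rightarrow> nat \<Rightarrow> nat \<Rightarrow> nat \<Rightarrow> nat" where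
  "displacement_bound s n k r = s * n ^ (2 * r) * 2 ^ (Suc (k * r) * (k * r))"

text \<open>The relation \<open>E x\<close> describes how state and head position may change on the tape \<open>x\<close>; it sees the tape
  up to distance \<open>r\<close> from the head. The value \<open>cls x j\<close> is what has to be remembered of the
  tape to the left of \<open>j\<close> to know that pumping stays inside \<open>X\<close>.\<close>

locale local_dynamics =
  fixes X :: "(int \<Rightarrow> 'a::finite) set" and k r :: nat
    and E :: "(int \<Rightarrow> 'a) \<Rightarrow> nat \<times> int \<Rightarrow> nat \<times> int \<Rightarrow> bool"
    and cls :: "(int \<Rightarrow> 'a) \<Rightarrow> int \<Rightarrow> 'c" and Z :: "'c set"
  assumes shift_closed: "x \<in> X \<Longrightarrow> shift m x \<in> X"
    and E_range: "x \<in> X \<Longrightarrow> E x (q, i) (q', i') \<Longrightarrow> q' \<in> {1..k} \<and> \<bar>i' - i\<bar> \<le> int r"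
    and E_local: "x \<in> X \<Longrightarrow> y \<in> X \<Longrightarrow> (\<And>t. \<bar>t\<bar> \<le> int r \<Longrightarrow> y (j + t) = x (i + t)) \<Longrightarrow>
      E x (q, i) (q', i') \<Longrightarrow> E y (q, j) (q', i' + (j - i))"
    and finite_Z: "finite Z"
    and cls_in: "x \<in> X \<Longrightarrow> cls x j \<in> Z"
    and glue_in: "x \<in> X \<Longrightarrow> j < j' \<Longrightarrow> cls x j = cls x j' \<Longrightarrow> glue j j' x \<in> X"
begin

abbreviation left_step :: "(int \<Rightarrow> 'a) \<Rightarrow> int \<Rightarrow> nat \<times> int \<Rightarrow> nat \<times> int \<Rightarrow> bool" where
  "left_step x j u v \<equiv> E x u v \<and> snd u < j"

text \<open>A trajectory that starts in \<open>s\<close>, to the left of a cut, is in the left part initially (\<^term>\<open>None\<close>),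
  and each later time that it steps over the cut from the right it lands at most \<open>r\<close> cells before
  the cut. When it leaves the left part, it lands less than \<open>r\<close> cells beyond the cut. Positions are
  relative to the cut, which makes different cuts comparable.\<close>

definition entries :: "(nat \<times> int) option set" where
  "entries = insert None (Some ` ({1..k} \<times> {- int r..<0}))"

definition exits :: "(nat \<times> int) set" where
  "exits = {1..k} \<times> {0..<int r}"

definition entry_pos :: "nat \<times> int \<Rightarrow> int \<Rightarrow> (nat \<times> int) option \<Rightarrow> nat \<times> int" where
  "entry_pos s j a = (case a of None \<Rightarrow> s | Some (p, t) \<Rightarrow> (p, j + t))"

text \<open>Together with the pattern around the cut, this is all that a trajectory can notice of the part of
  the tape to the left of the cut: which excursions, from entry to exit, are possible there.\<close>

definition crossing :: "(int \<Rightarrow> 'a) \<Rightarrow> nat \<times> int \<Rightarrow> int \<Rightarrow> ((nat \<times> int) option \<times> (nat \<times> int)) set" where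
  "crossing x s j = {(a, e) \<in> entries \<times> exits.
     (left_step x j)\<^sup>*\<^sup>* (entry_pos s j a) (fst e, j + snd e)}"

definition cut_type :: "(int \<Rightarrow> 'a) \<Rightarrow> nat \<times> int \<Rightarrow> int \<Rightarrow>
    'c \<times> (int \<Rightarrow> 'a) \<times> ((nat \<times> int) option \<times> (nat \<times> int)) set" where
  "cut_type x s j = (cls x j, (\<lambda>t\<in>{- int r..<int r}. x (j + t)), crossing x s j)"

definition cut_types :: "('c \<times> (int \<Rightarrow> 'a) \<times> ((nat \<times> int) option \<times> (nat \<times> int)) set) set" where
  "cut_types = Z \<times> ({- int r..<int r} \<rightarrow>\<^sub>E UNIV) \<times> Pow (entries \<times> exits)"

lemma cut_type_in: "x \<in> X \<Longrightarrow> cut_type x s j \<in> cut_types"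
  by (auto simp: cut_type_def cut_types_def cls_in crossing_def)

lemma finite_card_cut_types:
  "finite cut_types" "card cut_types = displacement_bound (card Z) (card (UNIV :: 'a set)) k r"
proof -
  have fin: "finite entries" "finite exits"
    by (auto simp: entries_def exits_def)
  have "card entries = Suc (k * r)"
    unfolding entries_def by (subst card_insert_disjoint) (auto simp: card_image card_cartesian_product)
  moreover have "card exits = k * r"
    by (simp add: exits_def card_cartesian_product)
  ultimately show "card cut_types = displacement_bound (card Z) (card (UNIV :: 'a set)) k r"
    using fin by (simp add: cut_types_def displacement_bound_def card_cartesian_product card_Pow card_PiE
        nat_mult_distrib)
  show "finite cut_types"
    using fin finite_Z by (auto simp: cut_types_def intro!: finite_cartesian_product finite_PiE)
qed

text \<open>A trajectory on \<open>x\<close> is imitated on the glued tape. The steps made to the right of \<open>j\<close> are the same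
  steps to the right of \<open>j'\<close>. An excursion to the left of \<open>j\<close> is replaced by an excursion to the
  left of \<open>j'\<close> with the corresponding entry and exit; it exists since both cuts have the same
  crossing relation. As the trajectory ends to the right of \<open>j\<close>, the imitation ends \<open>j' - j\<close> cells
  further to the right.\<close>

lemma pump:
  assumes x: "x \<in> X" and j: "snd s < j" "j < j'" and same: "cut_type x s j = cut_type x s j'"
    and reach: "(E x)\<^sup>*\<^sup>* s v" and v: "j \<le> snd v"
  shows "glue j j' x \<in> X" "(E (glue j j' x))\<^sup>*\<^sup>* s (fst v, snd v + (j' - j))"
proof -
  define y where "y = glue j j' x"
  define p where "p = j' - j"
  have cls: "cls x j = cls x j'" and cross: "crossing x s j = crossing x s j'"
    and pat: "(\<lambda>t\<in>{- int r..<int r}. x (j + t)) = (\<lambda>t\<in>{- int r..<int r}. x (j' + t))"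
    using same by (auto simp: cut_type_def)
  have pat': "x (j + t) = x (j' + t)" if "- int r \<le> t" "t < int r" for t
    using fun_cong[OF pat, of t] that by simp
  show y: "glue j j' x \<in> X"
    using glue_in[OF x j(2) cls] .
  have right: "E y (fst u, snd u + p) (fst w, snd w + p)" if "E x u w" "j \<le> snd u" for u w
  proof -
    have "y (snd u + p + t) = x (snd u + t)" if "\<bar>t\<bar> \<le> int r" for t
      using pat'[of "snd u + t - j"] that \<open>j \<le> snd u\<close>
      by (auto simp: y_def glue_def p_def algebra_simps)
    from E_local[OF x y[folded y_def] this, of "fst u" "fst w" "snd w"] that(1)
    show ?thesis by (simp add: algebra_simps)
  qed
  have left: "E y u w" if "left_step x j' u w" for u w
  proof -
    have "y (snd u + t) = x (snd u + t)" if "\<bar>t\<bar> \<le> int r" for t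
      using pat'[of "snd u + t - j'"] that \<open>left_step x j' u w\<close>
      by (auto simp: y_def glue_def p_def algebra_simps)
    from E_local[OF x y[folded y_def] this, of "fst u" "fst w" "snd w"] that(1)
    show ?thesis by simp
  qed
  have left_rtrancl: "(E y)\<^sup>*\<^sup>* u w" if "(left_step x j')\<^sup>*\<^sup>* u w" for u w
    using that left by (rule mono_rtranclp[rule_format, rotated]) auto
  \<comment> \<open>During an excursion the imitation waits at the entry: only the exit determines which way it goes.\<close>
  have "if j \<le> snd v then (E y)\<^sup>*\<^sup>* s (fst v, snd v + p)
        else \<exists>a\<in>entries. (E y)\<^sup>*\<^sup>* s (entry_pos s j' a) \<and> (left_step x j)\<^sup>*\<^sup>* (entry_pos s j a) v"
    using reach
  proof induction
    case base
    show ?case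
      using j by (auto intro!: bexI[of _ None] simp: entries_def entry_pos_def)
  next
    case (step u w)
    have rng: "fst w \<in> {1..k}" "\<bar>snd w - snd u\<bar> \<le> int r"
      using E_range[OF x, of "fst u" "snd u" "fst w" "snd w"] step.hyps(2) by auto
    show ?case
    proof (cases "j \<le> snd u")
      case True
      then have ru: "(E y)\<^sup>*\<^sup>* s (fst w, snd w + p)"
        using step.IH right[OF step.hyps(2) True] by (auto intro: rtranclp.rtrancl_into_rtrancl)
      show ?thesis
      proof (cases "j \<le> snd w")
        case False
        let ?a = "Some (fst w, snd w - j)"
        have "?a \<in> entries"
          using rng True False by (auto simp: entries_def)
        moreover have "entry_pos s j ?a = w" "entry_pos s j' ?a = (fst w, snd w + p)"
          by (auto simp: entry_pos_def p_def)
        ultimately have "\<exists>a\<in>entries. (E y)\<^sup>*\<^sup>* s (entry_pos s j' a) \<and>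
            (left_step x j)\<^sup>*\<^sup>* (entry_pos s j a) w"
          using ru by (intro bexI[of _ ?a]) auto
        then show ?thesis using False by simp
      qed (use ru in simp)
    next
      case False
      with step.IH obtain a where a: "a \<in> entries" "(E y)\<^sup>*\<^sup>* s (entry_pos s j' a)"
          "(left_step x j)\<^sup>*\<^sup>* (entry_pos s j a) u" by auto
      have lw: "(left_step x j)\<^sup>*\<^sup>* (entry_pos s j a) w"
        by (rule rtranclp.rtrancl_into_rtrancl[OF a(3)]) (use step.hyps(2) False in auto)
      show ?thesis
      proof (cases "j \<le> snd w")
        case True
        have "(a, (fst w, snd w - j)) \<in> crossing x s j"
          using a(1) lw rng True False by (auto simp: crossing_def exits_def)
        then have "(left_step x j')\<^sup>*\<^sup>* (entry_pos s j' a) (fst w, snd w + p)"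
          unfolding cross by (auto simp: crossing_def p_def algebra_simps)
        then have "(E y)\<^sup>*\<^sup>* s (fst w, snd w + p)"
          using a(2) left_rtrancl by (blast intro: rtranclp_trans)
        then show ?thesis using True by simp
      qed (use a lw in auto)
    qed
  qed
  then show "(E (glue j j' x))\<^sup>*\<^sup>* s (fst v, snd v + (j' - j))"
    using v by (simp add: y_def p_def)
qed

text \<open>Consider the largest displacement to the right that occurs. If it exceeded the number of cut types, two of the
  cuts that are passed would have the same type, and pumping would produce a larger displacement.\<close>

lemma right_displacement_le:
  assumes bounded: "\<And>x q q' i. x \<in> X \<Longrightarrow> (E x)\<^sup>*\<^sup>* (q, 0) (q', i) \<Longrightarrow> i \<le> D"
    and x: "x \<in> X" and reach: "(E x)\<^sup>*\<^sup>* (q, 0) (q', i)"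
  shows "i \<le> int (displacement_bound (card Z) (card (UNIV :: 'a set)) k r)"
proof (rule ccontr)
  let ?N = "displacement_bound (card Z) (card (UNIV :: 'a set)) k r"
  assume "\<not> ?thesis"
  then have i: "int ?N < i" by simp
  define R where "R = {n. \<exists>x\<in>X. \<exists>q q'. (E x)\<^sup>*\<^sup>* (q, 0) (q', int n)}"
  have "R \<subseteq> {..nat D}"
    using bounded by (fastforce simp: R_def)
  then have finR: "finite R" by (rule finite_subset) simp
  have iR: "nat i \<in> R"
    using x reach i by (auto simp: R_def)
  define n where "n = Max R"
  have nR: "n \<in> R" and n: "nat i \<le> n"
    unfolding n_def using Max_in[OF finR] Max_ge[OF finR iR] iR by blast+
  then obtain x q q' where x: "x \<in> X" and reach: "(E x)\<^sup>*\<^sup>* (q, 0) (q', int n)"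
    by (auto simp: R_def)
  have "\<not> inj_on (cut_type x (q, 0)) {1..int n}"
  proof
    assume "inj_on (cut_type x (q, 0)) {1..int n}"
    then have "card {1..int n} \<le> card cut_types"
      by (rule card_inj_on_le) (use cut_type_in[OF x] finite_card_cut_types in auto)
    then show False using finite_card_cut_types(2) i n by simp
  qed
  then obtain j j' where j: "0 < j" "j < j'" "j' \<le> int n"
    and same: "cut_type x (q, 0) j = cut_type x (q, 0) j'"
    unfolding inj_on_def by (metis atLeastAtMost_iff linorder_neqE_linordered_idom zless_iff_Suc_zadd int_one_le_iff_zero_less)
  have "(E (glue j j' x))\<^sup>*\<^sup>* (q, 0) (q', int n + (j' - j))" "glue j j' x \<in> X"
    using pump[OF x _ j(2) same reach] j by auto
  then have "n + nat (j' - j) \<in> R"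
    using j by (auto simp: R_def)
  then have "n + nat (j' - j) \<le> n"
    unfolding n_def using finR by (intro Max_ge) auto
  then show False using j by simp
qed

end

definition reflect :: "(int \<Rightarrow> 'a) \<Rightarrow> int \<Rightarrow> 'a" where
  "reflect x = (\<lambda>i. x (- i))"

lemma reflect_reflect [simp]: "reflect (reflect x) = x"
  by (simp add: reflect_def)

text \<open>A cut at \<open>j\<close> separates the cells \<open>j - 1\<close> and \<open>j\<close>, so its mirror image is the cut at \<open>1 - j\<close>. Both
  repetitions of the segment give the same tape up to a shift.\<close>

lemma reflect_glue:
  "reflect (glue j j' x) = shift (j - j') (glue (1 - j') (1 - j) (reflect x))"
  by (auto simp: reflect_def glue_def shift_def fun_eq_iff algebra_simps)

context local_dynamics
begin

text \<open>By the previous lemma, the classes of left contexts also control pumping of the reflected tapes, so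
  bounds for displacements to the right turn into bounds for displacements to the left.\<close>

lemma reflected:
  "local_dynamics {x. reflect x \<in> X} k r
     (\<lambda>x u v. E (reflect x) (fst u, - snd u) (fst v, - snd v)) (\<lambda>x j. cls (reflect x) (1 - j)) Z"
proof
  fix x m assume "x \<in> {x. reflect x \<in> X}"
  moreover have "reflect (shift m x) = shift (- m) (reflect x)"
    by (auto simp: reflect_def shift_def algebra_simps)
  ultimately show "shift m x \<in> {x. reflect x \<in> X}"
    using shift_closed by auto
next
  fix x q i q' i'
  assume "x \<in> {x. reflect x \<in> X}" "E (reflect x) (fst (q, i), - snd (q, i)) (fst (q', i'), - snd (q', i'))"
  then show "q' \<in> {1..k} \<and> \<bar>i' - i\<bar> \<le> int r"
    using E_range[of "reflect x" q "- i" q' "- i'"] by auto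
next
  fix x y j i q q' i'
  assume *: "x \<in> {x. reflect x \<in> X}" "y \<in> {x. reflect x \<in> X}"
    "\<And>t. \<bar>t\<bar> \<le> int r \<Longrightarrow> y (j + t) = x (i + t)"
    "E (reflect x) (fst (q, i), - snd (q, i)) (fst (q', i'), - snd (q', i'))"
  have "reflect y (- j + t) = reflect x (- i + t)" if "\<bar>t\<bar> \<le> int r" for t
    using *(3)[of "- t"] that by (simp add: reflect_def algebra_simps)
  from E_local[of "reflect x" "reflect y" "- j" "- i" q q' "- i'", OF _ _ this] *(1,2,4)
  show "E (reflect y) (fst (q, j), - snd (q, j)) (fst (q', i' + (j - i)), - snd (q', i' + (j - i)))"
    by (simp add: algebra_simps)
next
  fix x j j' assume "x \<in> {x. reflect x \<in> X}" "j < j'"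
    "cls (reflect x) (1 - j) = cls (reflect x) (1 - j')"
  then show "glue j j' x \<in> {x. reflect x \<in> X}"
    using glue_in[of "reflect x" "1 - j'" "1 - j"] shift_closed by (simp add: reflect_glue)
qed (use finite_Z cls_in in auto)

lemma displacement_le:
  assumes bounded: "\<And>x q q' i. x \<in> X \<Longrightarrow> (E x)\<^sup>*\<^sup>* (q, 0) (q', i) \<Longrightarrow> \<bar>i\<bar> \<le> D"
    and x: "x \<in> X" and reach: "(E x)\<^sup>*\<^sup>* (q, 0) (q', i)"
  shows "\<bar>i\<bar> \<le> int (displacement_bound (card Z) (card (UNIV :: 'a set)) k r)"
proof -
  let ?E = "\<lambda>x u v. E (reflect x) (fst u, - snd u) (fst v, - snd v)"
  interpret R: local_dynamics "{x. reflect x \<in> X}" k r ?E "\<lambda>x j. cls (reflect x) (1 - j)" Z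
    by (rule reflected)
  have E_R: "(E (reflect x))\<^sup>*\<^sup>* (fst u, - snd u) (fst v, - snd v)" if "(?E x)\<^sup>*\<^sup>* u v" for x u v
    using that by induction (auto intro: rtranclp.rtrancl_into_rtrancl)
  have R_E: "(?E (reflect x))\<^sup>*\<^sup>* (fst u, - snd u) (fst v, - snd v)" if "(E x)\<^sup>*\<^sup>* u v" for x u v
    using that by induction (auto intro: rtranclp.rtrancl_into_rtrancl)
  have "i \<le> int (displacement_bound (card Z) (card (UNIV :: 'a set)) k r)"
    using right_displacement_le[OF _ x reach, of D] bounded by fastforce
  moreover have "- i \<le> int (displacement_bound (card Z) (card (UNIV :: 'a set)) k r)"
  proof (rule R.right_displacement_le[of D "reflect x" q q'])
    fix x q q' i assume "x \<in> {x. reflect x \<in> X}" "(?E x)\<^sup>*\<^sup>* (q, 0) (q', i)"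
    then show "i \<le> D"
      using bounded[of "reflect x" q q' "- i"] E_R[of x "(q, 0)" "(q', i)"] by auto
  qed (use x R_E[OF reach] in auto)
  ultimately show ?thesis by simp
qed

end


section \<open>Gluing in sofic subshifts\<close>

text \<open>A subshift is closed in the product of discrete spaces, where a neighbourhood of \<open>y\<close> fixes
  finitely many cells.\<close>

lemma subshift_memI:
  assumes X: "subshift X" and approx: "\<And>n::nat. \<exists>z\<in>X. \<forall>i. \<bar>i\<bar> \<le> int n \<longrightarrow> z i = y i"
  shows "y \<in> X"
proof (rule ccontr)
  let ?T = "product_topology (\<lambda>_::int. discrete_topology (UNIV :: 'a set)) UNIV"
  assume y: "y \<notin> X"
  have "openin ?T (topspace ?T - X)"
    using X by (auto simp: subshift_def closedin_def)
  moreover have "topspace ?T - X = - X"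
    by (auto simp: topspace_product_topology)
  ultimately have "openin ?T (- X)" by simp
  then have "\<forall>x\<in>- X. \<exists>U. finite {i. U i \<noteq> UNIV} \<and> x \<in> Pi\<^sub>E UNIV U \<and> Pi\<^sub>E UNIV U \<subseteq> - X"
    by (simp add: openin_product_topology_alt)
  then obtain U where U: "finite {i. U i \<noteq> UNIV}" "y \<in> Pi\<^sub>E UNIV U" "Pi\<^sub>E UNIV U \<subseteq> - X"
    using y by (meson ComplI)
  define n where "n = Max (insert 0 ((\<lambda>i. nat \<bar>i\<bar>) ` {i. U i \<noteq> UNIV}))"
  have n: "\<bar>i\<bar> \<le> int n" if "U i \<noteq> UNIV" for i
  proof -
    have "nat \<bar>i\<bar> \<le> n" unfolding n_def using U(1) that by (intro Max_ge) auto
    then show ?thesis by simp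
  qed
  obtain z where z: "z \<in> X" "\<forall>i. \<bar>i\<bar> \<le> int n \<longrightarrow> z i = y i"
    using approx by blast
  have "z i \<in> U i" for i
    using n[of i] z(2) U(2) by (cases "U i = UNIV") (auto dest: PiE_mem)
  then show False
    using U(3) z(1) by auto
qed

lemma language_windowE:
  assumes X: "subshift X" and w: "w \<in> language X" and len: "length w = nat (d - c + 1)"
  obtains z where "z \<in> X" "map z [c..d] = w"
proof -
  obtain x a b where x: "x \<in> X" and w: "w = map x [a..b]"
    using assms(2) by (auto simp: language_def)
  have "map (shift (c - a) x) [c..d] = w"
  proof (rule nth_equalityI)
    fix i assume i: "i < length (map (shift (c - a) x) [c..d])"
    then have "c + int i \<le> d" "a + int i \<le> b"
      using len by (auto simp: w)
    then show "map (shift (c - a) x) [c..d] ! i = w ! i"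
      using i len by (simp add: w nth_upto shift_def algebra_simps)
  qed (use len in simp)
  moreover have "shift (c - a) x \<in> X"
    using X x by (auto simp: subshift_def)
  ultimately show thesis using that by blast
qed

lemma language_factor: "u @ v \<in> language X \<Longrightarrow> v \<in> language X"
proof -
  assume "u @ v \<in> language X"
  then obtain x a b where x: "x \<in> X" and uv: "u @ v = map x [a..b]"
    by (auto simp: language_def)
  then have len: "length u + length v = nat (b - a + 1)"
    by (metis length_append length_map length_upto)
  have "v = map x [a + int (length u)..b]"
  proof (cases "v = []")
    case False
    then have "0 < length v" by simp
    show ?thesis
    proof (rule nth_equalityI)
      fix i assume i: "i < length v"
      then have "v ! i = map x [a..b] ! (length u + i)"
        by (metis uv nth_append_length_plus)
      then show "v ! i = map x [a + int (length u)..b] ! i"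
        using i len by (simp add: nth_upto algebra_simps)
    qed (use len \<open>0 < length v\<close> in auto)
  qed (use len in simp)
  then show ?thesis using x by (auto simp: language_def)
qed

text \<open>The right contexts of a whole left half-line. With a finite left context of fixed length in its
  place, gluing would produce a tape whose long windows might leave the language.\<close>

definition followers :: "(int \<Rightarrow> 'a) set \<Rightarrow> (int \<Rightarrow> 'a) \<Rightarrow> int \<Rightarrow> 'a list set" where
  "followers X x j = {u. \<forall>n. map x [j - int n..j - 1] @ u \<in> language X}"

text \<open>Longer left contexts have fewer right contexts, and those of a finite left context are determined
  by a state of the automaton. A decreasing sequence with finitely many values reaches its
  intersection, so the set of followers also belongs to a state.\<close>

lemma finite_followers:
  assumes "regular (language X)"
  shows "\<exists>Z. finite Z \<and> (\<forall>x j. followers X x j \<in> Z)"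
proof -
  obtain S :: "nat set" and s0 A \<delta> where S: "finite S" "s0 \<in> S" "\<forall>s\<in>S. \<forall>a. \<delta> s a \<in> S"
    and L: "language X = {w. foldl \<delta> s0 w \<in> A}"
    using assms unfolding regular_def by blast
  define res where "res s = {u. foldl \<delta> s u \<in> A}" for s
  have foldl_S: "foldl \<delta> s w \<in> S" if "s \<in> S" for s w
    using that S(3) by (induction w arbitrary: s) auto
  have "followers X x j \<in> res ` S" for x j
  proof -
    define f where "f n = res (foldl \<delta> s0 (map x [j - int n..j - 1]))" for n
    have f_eq: "f n = {u. map x [j - int n..j - 1] @ u \<in> language X}" for n
      by (auto simp: f_def res_def L)
    have mono: "f (Suc n) \<subseteq> f n" for n
    proof -
      have "[j - int (Suc n)..j - 1] = (j - int (Suc n)) # [j - int n..j - 1]"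
        by (subst upto_rec1) auto
      then show ?thesis
        unfolding f_eq using language_factor[of "[x (j - int (Suc n))]"] by auto
    qed
    have anti: "f n \<subseteq> f m" if "m \<le> n" for m n
      using that by (rule lift_Suc_antimono_le[of f, OF mono])
    have range: "range f \<subseteq> res ` S"
      using foldl_S[OF S(2)] by (auto simp: f_def)
    then have "finite (range f)"
      using S(1) finite_subset by blast
    then obtain M where M: "M \<in> range f" "\<forall>b\<in>range f. b \<subseteq> M \<longrightarrow> M = b"
      using finite_has_minimal[of "range f"] by auto
    then obtain m where m: "M = f m" by blast
    have "f m \<subseteq> f n" for n
      using anti[of m n] anti[of n m] M m by (metis linorder_linear order.refl rangeI)
    then have "(\<Inter>n. f n) = f m" by auto
    moreover have "followers X x j = (\<Inter>n. f n)"
      by (auto simp: followers_def f_eq)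
    ultimately show ?thesis using M m range by auto
  qed
  moreover have "finite (res ` S)" using S(1) by simp
  ultimately show ?thesis by blast
qed

text \<open>A window of the glued tape consists of a left context of \<open>j'\<close> and of a word that stands to the
  right of \<open>j\<close> in \<open>x\<close>. The latter follows \<open>j\<close>, hence also \<open>j'\<close>.\<close>

lemma glue_in_subshift:
  assumes X: "subshift X" and x: "x \<in> X" and j: "j < j'"
    and eq: "followers X x j = followers X x j'"
  shows "glue j j' x \<in> X"
proof (rule subshift_memI[OF X])
  fix n :: nat
  define N where "N = int n + \<bar>j'\<bar>"
  let ?u = "map x [j..N - (j' - j)]"
  have "?u \<in> followers X x j"
    unfolding followers_def
  proof (intro CollectI allI)
    fix m
    have "[j - int m..N - (j' - j)] = [j - int m..j - 1] @ [j..N - (j' - j)]"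
      using upto_split1[of "j - int m" j "N - (j' - j)"] j by (auto simp: N_def)
    then have "map x [j - int m..j - 1] @ ?u = map x [j - int m..N - (j' - j)]" by simp
    then show "map x [j - int m..j - 1] @ ?u \<in> language X"
      using x by (auto simp: language_def)
  qed
  then have "?u \<in> followers X x j'" by (simp only: eq)
  then have "map x [j' - int (nat (j' + N))..j' - 1] @ ?u \<in> language X"
    by (simp only: followers_def mem_Collect_eq)
  moreover have "j' - int (nat (j' + N)) = - N"
    by (auto simp: N_def)
  moreover have "map x [- N..j' - 1] @ ?u = map (glue j j' x) [- N..N]"
  proof -
    have "[- N..N] = [- N..j' - 1] @ [j'..N]"
      by (rule upto_split1) (auto simp: N_def)
    moreover have "map x [- N..j' - 1] = map (glue j j' x) [- N..j' - 1]"
      by (auto simp: glue_def)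
    moreover have "?u = map (glue j j' x) [j'..N]"
      by (rule nth_equalityI) (auto simp: glue_def nth_upto algebra_simps)
    ultimately show ?thesis by simp
  qed
  ultimately have "map (glue j j' x) [- N..N] \<in> language X" by simp
  then obtain z where "z \<in> X" "map z [- N..N] = map (glue j j' x) [- N..N]"
    by (rule language_windowE[OF X, of _ N "- N"]) auto
  moreover have "i \<in> set [- N..N]" if "\<bar>i\<bar> \<le> int n" for i
    using that unfolding N_def by simp linarith
  ultimately show "\<exists>z\<in>X. \<forall>i. \<bar>i\<bar> \<le> int n \<longrightarrow> z i = glue j j' x i"
    by (metis map_eq_conv)
qed


section \<open>The action of tables\<close>

fun table_step :: "(int \<Rightarrow> 'a) \<Rightarrow> 'a table \<Rightarrow> nat \<times> int \<Rightarrow> nat \<times> int" where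
  "table_step x (Fs, t) (q, i) =
     (let v = the (map_of t (map (\<lambda>f. x (i + f)) Fs, q)) in (fst v, i + snd v))"

definition word_step :: "(int \<Rightarrow> 'a) \<Rightarrow> 'a table list \<Rightarrow> nat \<times> int \<Rightarrow> nat \<times> int" where
  "word_step x w = foldr (table_step x) w"

lemma word_step_simps [simp]:
  "word_step x [] c = c"
  "word_step x (p # w) c = table_step x p (word_step x w c)"
  by (simp_all add: word_step_def)

lemma add_le_prod_encode: "a + b \<le> prod_encode (a, b)"
proof -
  have "n \<le> triangle n" for n by (induction n) auto
  from this[of "a + b"] show ?thesis by (simp add: prod_encode_def)
qed

lemma list_encode_Cons_ge: "a + list_encode xs < list_encode (a # xs)"
  using add_le_prod_encode[of a "list_encode xs"] by simp

lemma member_le_list_encode: "a \<in> set xs \<Longrightarrow> a \<le> list_encode xs"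
proof (induction xs)
  case (Cons b xs)
  then show ?case using list_encode_Cons_ge[of b xs] by auto
qed simp

lemma abs_le_int_encode: "\<bar>i\<bar> \<le> int (int_encode i)"
  by (auto simp: int_encode_def sum_encode_def)

text \<open>Codes of pairs and lists dominate the codes of their parts, even the sum of these codes. The code of
  a table is therefore a radius for it, the code of a word is a radius for the composition, and the
  code of the whole input is a common radius for all generators, which a program has at hand.\<close>

lemma window_le_encode_table: "f \<in> set Fs \<Longrightarrow> \<bar>f\<bar> \<le> int (encode_table enc (Fs, t))"
proof -
  assume "f \<in> set Fs"
  then have "int_encode f \<le> list_encode (map int_encode Fs)"
    by (intro member_le_list_encode) auto
  also have "\<dots> \<le> encode_table enc (Fs, t)"
    by (simp add: le_prod_encode_1)
  finally show ?thesis using abs_le_int_encode[of f] by linarith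
qed

lemma move_le_encode_table:
  "((u, q), (q', m)) \<in> set t \<Longrightarrow> \<bar>m\<bar> \<le> int (encode_table enc (Fs, t))"
proof -
  assume t: "((u, q), (q', m)) \<in> set t"
  have "int_encode m \<le> encode_entry enc ((u, q), (q', m))"
    using le_prod_encode_2[of "int_encode m" q'] by (auto intro: order_trans[OF _ le_prod_encode_2])
  also have "\<dots> \<le> list_encode (map (encode_entry enc) t)"
    by (rule member_le_list_encode) (use t in \<open>auto intro: rev_image_eqI\<close>)
  also have "\<dots> \<le> encode_table enc (Fs, t)"
    by (simp add: le_prod_encode_2)
  finally show ?thesis using abs_le_int_encode[of m] by linarith
qed

definition encode_word :: "('a \<Rightarrow> nat) \<Rightarrow> 'a table list \<Rightarrow> nat" where
  "encode_word enc w = list_encode (map (encode_table enc) w)"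

lemma encode_word_Cons: "encode_table enc p + encode_word enc w \<le> encode_word enc (p # w)"
  unfolding encode_word_def using list_encode_Cons_ge[of "encode_table enc p" "map (encode_table enc) w"]
  by simp

lemma encode_word_le: "w \<in> set ws \<Longrightarrow> encode_word enc w \<le> encode_words enc ws"
  unfolding encode_words_def encode_word_def by (rule member_le_list_encode) auto

lemma table_step_local:
  assumes "\<And>s. \<bar>s\<bar> \<le> int (encode_table enc p) \<Longrightarrow> y (j + s) = x (i + s)"
  shows "table_step y p (q, j) = (fst (table_step x p (q, i)), snd (table_step x p (q, i)) + (j - i))"
proof -
  obtain Fs t where p: "p = (Fs, t)" by fastforce
  have eq: "map (\<lambda>f. y (j + f)) Fs = map (\<lambda>f. x (i + f)) Fs"
    using assms window_le_encode_table[of _ Fs enc t] by (auto simp: p)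
  show ?thesis unfolding p table_step.simps eq by (simp add: Let_def)
qed

lemma table_step_range:
  assumes wf: "table_wf X k p" and x: "\<And>m. shift m x \<in> X" and q: "q \<in> {1..k}"
  shows "fst (table_step x p (q, i)) \<in> {1..k}"
    "\<bar>snd (table_step x p (q, i)) - i\<bar> \<le> int (encode_table enc p)"
    "table_map X k p (x, q, i) = (x, table_step x p (q, i))"
proof -
  obtain Fs t where p: "p = (Fs, t)" by fastforce
  have eq: "map (shift (- i) x) Fs = map (\<lambda>f. x (i + f)) Fs"
    by (auto simp: shift_def add.commute)
  have "(map (shift (- i) x) Fs, q) \<in> {(map x Fs, q) | x q. x \<in> X \<and> q \<in> {1..k}}"
    using x[of "- i"] q by blast
  then have "(map (\<lambda>f. x (i + f)) Fs, q) \<in> dom (map_of t)"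
    using wf unfolding p eq by simp
  then obtain q' m where v: "map_of t (map (\<lambda>f. x (i + f)) Fs, q) = Some (q', m)"
    by fastforce
  have "(q', m) \<in> ran (map_of t)"
    using v by (rule ranI)
  then have q': "q' \<in> {1..k}"
    using wf by (auto simp: p)
  have "x \<in> X"
    using x[of 0] by (simp add: shift_def)
  have eq': "map (restrict (shift (- i) x) (set Fs)) Fs = map (\<lambda>f. x (i + f)) Fs"
    using eq by auto
  show "table_map X k p (x, q, i) = (x, table_step x p (q, i))"
    using q \<open>x \<in> X\<close> by (simp add: p rule_map_def configs_def eq' v)
  show "fst (table_step x p (q, i)) \<in> {1..k}"
    using v q' by (simp add: p)
  show "\<bar>snd (table_step x p (q, i)) - i\<bar> \<le> int (encode_table enc p)"
    using move_le_encode_table[OF map_of_SomeD[OF v], of enc Fs] v by (simp add: p)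
qed

lemma word_step_range:
  assumes "\<forall>p\<in>set w. table_wf X k p" "\<And>m. shift m x \<in> X" "q \<in> {1..k}"
  shows "fst (word_step x w (q, i)) \<in> {1..k} \<and>
    \<bar>snd (word_step x w (q, i)) - i\<bar> \<le> int (encode_word enc w)"
  using assms
proof (induction w)
  case (Cons p w)
  obtain q1 i1 where c: "word_step x w (q, i) = (q1, i1)" by fastforce
  have "q1 \<in> {1..k}" "\<bar>i1 - i\<bar> \<le> int (encode_word enc w)"
    using Cons c by auto
  moreover have "int (encode_table enc p) + int (encode_word enc w) \<le> int (encode_word enc (p # w))"
    using encode_word_Cons[of enc p w] by linarith
  ultimately show ?case
    using table_step_range(1)[of X k p x q1 i1] table_step_range(2)[of X k p x q1 i1 enc] Cons.prems c
    by auto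
qed simp

lemma word_step_local:
  assumes "\<forall>p\<in>set w. table_wf X k p" "\<And>m. shift m x \<in> X" "q \<in> {1..k}"
    "\<And>s. \<bar>s\<bar> \<le> int (encode_word enc w) \<Longrightarrow> y (j + s) = x (i + s)"
  shows "word_step y w (q, j) = (fst (word_step x w (q, i)), snd (word_step x w (q, i)) + (j - i))"
  using assms
proof (induction w)
  case (Cons p w)
  obtain q1 i1 where c: "word_step x w (q, i) = (q1, i1)" by fastforce
  have code: "int (encode_table enc p) + int (encode_word enc w) \<le> int (encode_word enc (p # w))"
    using encode_word_Cons[of enc p w] by linarith
  have i1: "\<bar>i1 - i\<bar> \<le> int (encode_word enc w)"
    using word_step_range[of w X k x q i enc] Cons.prems c by auto
  have "word_step y w (q, j) = (q1, i1 + (j - i))"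
    using Cons.IH Cons.prems code c by auto
  moreover have "table_step y p (q1, i1 + (j - i)) =
      (fst (table_step x p (q1, i1)), snd (table_step x p (q1, i1)) + (i1 + (j - i) - i1))"
  proof (rule table_step_local)
    fix s assume "\<bar>s\<bar> \<le> int (encode_table enc p)"
    then have "\<bar>i1 - i + s\<bar> \<le> int (encode_word enc (p # w))"
      using i1 code by linarith
    from Cons.prems(4)[OF this] show "y (i1 + (j - i) + s) = x (i1 + s)"
      by (simp add: algebra_simps)
  qed
  ultimately show ?case using c by simp
qed simp

lemma word_value_apply:
  fixes X :: "(int \<Rightarrow> 'a::finite) set"
  assumes X: "subshift X" and w: "\<forall>p\<in>set w. presents_RFA_element X k p"
  shows "word_value X k w \<in> carrier (RFA X k)"
    and "x \<in> X \<Longrightarrow> q \<in> {1..k} \<Longrightarrow> word_value X k w (x, q, i) = (x, word_step x w (q, i))"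
proof -
  interpret group "RFA X k" by (rule group_RFA[OF X])
  have word_value_Cons: "word_value X k (p # w) = table_map X k p \<otimes>\<^bsub>RFA X k\<^esub> word_value X k w" for p w
    by (simp add: word_value_def)
  have word_value_Nil: "word_value X k [] = \<one>\<^bsub>RFA X k\<^esub>"
    by (simp add: word_value_def)
  show in_carrier: "word_value X k w \<in> carrier (RFA X k)"
    using w by (induction w) (auto simp: word_value_Cons word_value_Nil presents_RFA_element_def)
  assume x: "x \<in> X" and q: "q \<in> {1..k}"
  have sh: "shift m x \<in> X" for m using X x by (simp add: subshift_def)
  show "word_value X k w (x, q, i) = (x, word_step x w (q, i))"
    using w
  proof (induction w)
    case Nil
    then show ?case using x q by (simp add: word_value_Nil RFA_def BijGroup_def configs_def)
  next
    case (Cons p w)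
    have "word_value X k w \<in> carrier (RFA X k)"
      using Cons.prems by (induction w) (auto simp: word_value_Cons word_value_Nil presents_RFA_element_def)
    then have "word_value X k (p # w) = compose (configs X k) (table_map X k p) (word_value X k w)"
      using Cons.prems by (simp add: word_value_Cons RFA_def BijGroup_def RFA_carrier_def presents_RFA_element_def)
    moreover have "fst (word_step x w (q, i)) \<in> {1..k}"
      using word_step_range[of w X k x q i] Cons.prems sh q by (auto simp: presents_RFA_element_def)
    moreover have "table_wf X k p" using Cons.prems by (simp add: presents_RFA_element_def)
    ultimately show ?case
      using Cons x q table_step_range(3)[of X k p x "fst (word_step x w (q, i))" "snd (word_step x w (q, i))"] sh
      by (simp add: compose_def configs_def)
  qed
qed


section \<open>Finiteness and bounded displacement\<close>

text \<open>The tape never changes, so the group acts on each tape \<open>x\<close> separately, along the edges of this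
  graph on states and positions.\<close>

definition rfa_step :: "nat \<Rightarrow> 'a table list list \<Rightarrow> (int \<Rightarrow> 'a) \<Rightarrow> nat \<times> int \<Rightarrow> nat \<times> int \<Rightarrow> bool" where
  "rfa_step k ws x u v \<longleftrightarrow> fst u \<in> {1..k} \<and> (\<exists>w\<in>set ws. v = word_step x w u)"

definition run :: "(int \<Rightarrow> 'a) \<Rightarrow> 'a table list list \<Rightarrow> nat \<times> int \<Rightarrow> nat \<times> int" where
  "run x s = foldr (word_step x) s"

lemma run_simps [simp]:
  "run x [] c = c"
  "run x (w # s) c = word_step x w (run x s c)"
  by (simp_all add: run_def)

locale RFA_words =
  fixes X :: "(int \<Rightarrow> 'a::finite) set" and k :: nat and enc :: "'a \<Rightarrow> nat"
    and ws :: "'a table list list"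
  assumes X: "subshift X"
    and valid: "\<forall>w\<in>set ws. \<forall>p\<in>set w. presents_RFA_element X k p"
begin

sublocale group "RFA X k"
  by (rule group_RFA[OF X])

abbreviation G where "G \<equiv> RFA X k"

abbreviation radius :: nat where "radius \<equiv> encode_words enc ws"

lemma shift_in: "x \<in> X \<Longrightarrow> shift m x \<in> X"
  using X by (simp add: subshift_def)

lemma word_step_in:
  assumes "w \<in> set ws" "x \<in> X" "q \<in> {1..k}"
  shows "fst (word_step x w (q, i)) \<in> {1..k}" "\<bar>snd (word_step x w (q, i)) - i\<bar> \<le> int radius"
  using word_step_range[of w X k x q i enc] assms valid shift_in encode_word_le[OF assms(1), of enc]
  by (auto simp: presents_RFA_element_def)

lemma word_step_shifted:
  assumes "w \<in> set ws" "x \<in> X" "q \<in> {1..k}" "\<And>s. \<bar>s\<bar> \<le> int radius \<Longrightarrow> y (j + s) = x (i + s)"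
  shows "word_step y w (q, j) = (fst (word_step x w (q, i)), snd (word_step x w (q, i)) + (j - i))"
proof (rule word_step_local[of w X k x q enc])
  show "\<forall>p\<in>set w. table_wf X k p"
    using assms(1) valid by (auto simp: presents_RFA_element_def)
  show "y (j + s) = x (i + s)" if "\<bar>s\<bar> \<le> int (encode_word enc w)" for s
    using assms(4)[of s] that encode_word_le[OF assms(1), of enc] by linarith
qed (use assms shift_in in auto)

lemma run_in:
  assumes "set s \<subseteq> set ws" "x \<in> X" "q \<in> {1..k}"
  shows "fst (run x s (q, i)) \<in> {1..k}"
  using assms
proof (induction s)
  case (Cons w s)
  then show ?case
    using word_step_in(1)[of w x "fst (run x s (q, i))" "snd (run x s (q, i))"] by simp
qed simp

text \<open>While the head stays within distance \<open>N\<close> of its origin, only the cells up to distance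
  \<open>N + radius\<close> are read.\<close>

lemma run_local:
  assumes x: "x \<in> X" and q: "q \<in> {1..k}"
    and bound: "\<And>s. set s \<subseteq> set ws \<Longrightarrow> \<bar>snd (run x s (q, i)) - i\<bar> \<le> int N"
    and agree: "\<And>t. \<bar>t\<bar> \<le> int (N + radius) \<Longrightarrow> y (j + t) = x (i + t)"
    and s: "set s \<subseteq> set ws"
  shows "run y s (q, j) = (fst (run x s (q, i)), snd (run x s (q, i)) + (j - i))"
  using s
proof (induction s)
  case (Cons w s)
  obtain q1 i1 where c: "run x s (q, i) = (q1, i1)" by fastforce
  have "q1 \<in> {1..k}" "\<bar>i1 - i\<bar> \<le> int N"
    using run_in[of s x q i] bound[of s] x q Cons.prems c by auto
  moreover have "y (i1 + (j - i) + t) = x (i1 + t)" if "\<bar>t\<bar> \<le> int radius" for t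
    using agree[of "i1 - i + t"] that \<open>\<bar>i1 - i\<bar> \<le> int N\<close> by (simp add: algebra_simps)
  ultimately show ?case
    using word_step_shifted[of w x q1 y "i1 + (j - i)" i1] Cons x c by simp
qed simp

lemma reach_run:
  assumes "x \<in> X" "(rfa_step k ws x)\<^sup>*\<^sup>* u v"
  shows "\<exists>s. set s \<subseteq> set ws \<and> v = run x s u"
  using assms(2)
proof induction
  case base
  show ?case by (intro exI[of _ "[]"]) auto
next
  case (step v v')
  then obtain s w where "set s \<subseteq> set ws" "v = run x s u" "w \<in> set ws" "v' = word_step x w v"
    by (auto simp: rfa_step_def)
  then show ?case by (intro exI[of _ "w # s"]) auto
qed

lemma run_reach:
  assumes "x \<in> X" "q \<in> {1..k}" "set s \<subseteq> set ws"
  shows "(rfa_step k ws x)\<^sup>*\<^sup>* (q, i) (run x s (q, i))"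
  using assms(3)
proof (induction s)
  case (Cons w s)
  then have "rfa_step k ws x (run x s (q, i)) (run x (w # s) (q, i))"
    using run_in[of s x q i] assms by (auto simp: rfa_step_def)
  then show ?case using Cons by (auto intro: rtranclp.rtrancl_into_rtrancl)
qed simp

definition product :: "'a table list list \<Rightarrow> 'a config \<Rightarrow> 'a config" where
  "product s = foldr (\<lambda>w T. word_value X k w \<otimes>\<^bsub>G\<^esub> T) s \<one>\<^bsub>G\<^esub>"

lemma product_simps [simp]:
  "product [] = \<one>\<^bsub>G\<^esub>"
  "product (w # s) = word_value X k w \<otimes>\<^bsub>G\<^esub> product s"
  by (simp_all add: product_def)

lemma word_value_in [simp]: "w \<in> set ws \<Longrightarrow> word_value X k w \<in> carrier G"
  using word_value_apply(1)[OF X] valid by blast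

lemma product_in: "set s \<subseteq> set ws \<Longrightarrow> product s \<in> carrier G"
  by (induction s) auto

lemma product_in_generate:
  "set s \<subseteq> set ws \<Longrightarrow> product s \<in> generate G (word_value X k ` set ws)"
  by (induction s) (auto intro: generate.one generate.incl generate.eng)

lemma product_append:
  "set s \<subseteq> set ws \<Longrightarrow> set s' \<subseteq> set ws \<Longrightarrow> product (s @ s') = product s \<otimes>\<^bsub>G\<^esub> product s'"
  by (induction s) (auto simp: product_in m_assoc)

lemma product_apply:
  assumes "set s \<subseteq> set ws" "x \<in> X" "q \<in> {1..k}"
  shows "product s (x, q, i) = (x, run x s (q, i))"
  using assms(1)
proof (induction s)
  case Nil
  show ?case using assms by (simp add: RFA_def BijGroup_def configs_def)
next
  case (Cons w s)
  have "product s \<in> carrier G" "word_value X k w \<in> carrier G"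
    using Cons.prems product_in[of s] by auto
  then have "product (w # s) = compose (configs X k) (word_value X k w) (product s)"
    by (simp add: RFA_def BijGroup_def RFA_carrier_def)
  moreover have "fst (run x s (q, i)) \<in> {1..k}"
    using run_in[of s x q i] Cons.prems assms by auto
  moreover have "\<forall>p\<in>set w. presents_RFA_element X k p"
    using Cons.prems valid by auto
  ultimately show ?case
    using Cons assms word_value_apply(2)[OF X, of w k x "fst (run x s (q, i))" "snd (run x s (q, i))"]
    by (simp add: compose_def configs_def)
qed

text \<open>A local rule has finitely many arguments, so each single element of the group moves the head by a
  bounded distance.\<close>

lemma bounded_if_finite:
  assumes fin: "finite (generate G (word_value X k ` set ws))"
  shows "\<exists>D. \<forall>x\<in>X. \<forall>q\<in>{1..k}. \<forall>s. set s \<subseteq> set ws \<longrightarrow> \<bar>snd (run x s (q, 0))\<bar> \<le> D"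
proof -
  have "\<exists>d. \<forall>x\<in>X. \<forall>q\<in>{1..k}. \<bar>snd (snd (T (x, q, 0)))\<bar> \<le> d" if "T \<in> carrier G" for T
  proof -
    have "has_local_rule X k T"
      using that by (simp add: RFA_def RFA_carrier_def)
    then obtain F f where F: "finite F" and T: "T = rule_map X k F f"
      unfolding has_local_rule_def by blast
    have "patterns F X \<subseteq> PiE F (\<lambda>_. UNIV)"
      by (auto simp: patterns_def)
    then have "finite (patterns F X)"
      by (rule finite_subset) (simp add: F finite_PiE)
    then have fin: "finite ((\<lambda>p. \<bar>snd (f p)\<bar>) ` (patterns F X \<times> {1..k}))"
      by simp
    have "\<bar>snd (snd (T (x, q, 0)))\<bar> \<le> Max ((\<lambda>p. \<bar>snd (f p)\<bar>) ` (patterns F X \<times> {1..k}))"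
      if "x \<in> X" "q \<in> {1..k}" for x q
    proof (rule Max_ge[OF fin])
      have "shift 0 x = x" by (simp add: shift_def)
      then have "snd (snd (T (x, q, 0))) = snd (f (restrict x F, q))"
        using that by (simp add: T rule_map_def configs_def split_beta)
      then show "\<bar>snd (snd (T (x, q, 0)))\<bar> \<in> (\<lambda>p. \<bar>snd (f p)\<bar>) ` (patterns F X \<times> {1..k})"
        using that by (auto simp: patterns_def)
    qed
    then show ?thesis by blast
  qed
  then obtain d where d: "\<And>T x q. T \<in> carrier G \<Longrightarrow> x \<in> X \<Longrightarrow> q \<in> {1..k} \<Longrightarrow> \<bar>snd (snd (T (x, q, 0)))\<bar> \<le> d T"
    by metis
  let ?D = "Max (d ` generate G (word_value X k ` set ws))"
  have "\<bar>snd (run x s (q, 0))\<bar> \<le> ?D" if "x \<in> X" "q \<in> {1..k}" "set s \<subseteq> set ws" for x q s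
  proof -
    have "\<bar>snd (run x s (q, 0))\<bar> \<le> d (product s)"
      using d[OF product_in[OF that(3)] that(1,2)] product_apply[OF that(3,1,2), of 0] by simp
    also have "\<dots> \<le> ?D"
      using fin product_in_generate[OF that(3)] by (intro Max_ge) auto
    finally show ?thesis .
  qed
  then show ?thesis by blast
qed

text \<open>If the head never leaves \<open>[-N, N]\<close>, the action of a product is determined by a function from the
  finitely many patterns on \<open>W\<close> and the states to the finitely many states and positions. Each
  pattern is represented by one tape containing it.\<close>

lemma finite_products:
  assumes bound: "\<And>x q s. x \<in> X \<Longrightarrow> q \<in> {1..k} \<Longrightarrow> set s \<subseteq> set ws \<Longrightarrow> \<bar>snd (run x s (q, 0))\<bar> \<le> int N"
  shows "finite (product ` {s. set s \<subseteq> set ws})"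
proof -
  define W where "W = {- int (N + radius)..int (N + radius)}"
  define rep where "rep u = (SOME x. x \<in> X \<and> restrict x W = u)" for u
  define \<phi> :: "('a config \<Rightarrow> 'a config) \<Rightarrow> (int \<Rightarrow> 'a) \<times> nat \<Rightarrow> nat \<times> int" where
    "\<phi> T = (\<lambda>p\<in>patterns W X \<times> {1..k}. snd (T (rep (fst p), snd p, 0)))" for T
  have rep: "rep (restrict x W) \<in> X" "restrict (rep (restrict x W)) W = restrict x W" if "x \<in> X" for x
    using someI[of "\<lambda>y. y \<in> X \<and> restrict y W = restrict x W" x] that by (auto simp: rep_def)
  have run_rep: "run x s (q, i) =
      (fst (run (rep (restrict (shift (- i) x) W)) s (q, 0)),
       snd (run (rep (restrict (shift (- i) x) W)) s (q, 0)) + i)"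
    if x: "x \<in> X" "q \<in> {1..k}" "set s \<subseteq> set ws" for x q i s
  proof -
    define y where "y = rep (restrict (shift (- i) x) W)"
    note y = rep[OF shift_in[OF x(1)], of "- i", folded y_def]
    have agree: "x (i + t) = y (0 + t)" if "\<bar>t\<bar> \<le> int (N + radius)" for t
    proof -
      have "t \<in> W" using that by (auto simp: W_def)
      then show ?thesis using fun_cong[OF y(2), of t] by (simp add: shift_def add.commute)
    qed
    have "\<bar>snd (run y s (q, 0)) - 0\<bar> \<le> int N" if "set s \<subseteq> set ws" for s
      using bound[OF y(1) x(2) that] by simp
    from run_local[OF y(1) x(2) this agree x(3)] show ?thesis by (simp add: y_def[symmetric])
  qed
  have "inj_on \<phi> (product ` {s. set s \<subseteq> set ws})"
  proof (rule inj_onI)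
    fix T T' assume "T \<in> product ` {s. set s \<subseteq> set ws}" "T' \<in> product ` {s. set s \<subseteq> set ws}"
      and \<phi>: "\<phi> T = \<phi> T'"
    then obtain s s' where s: "set s \<subseteq> set ws" "set s' \<subseteq> set ws"
      and T: "T = product s" "T' = product s'" by blast
    have eq: "\<phi> (product s) = \<phi> (product s')" using \<phi> T by simp
    have ext: "product s \<in> extensional (configs X k)" "product s' \<in> extensional (configs X k)"
      using product_in[OF s(1)] product_in[OF s(2)]
      by (auto simp: RFA_def RFA_carrier_def Bij_def)
    show "T = T'"
      unfolding T
    proof (rule extensionalityI[OF ext])
      fix c :: "'a config" assume "c \<in> configs X k"
      then obtain x q i where c: "c = (x, q, i)" "x \<in> X" "q \<in> {1..k}"
        by (auto simp: configs_def)
      let ?u = "restrict (shift (- i) x) W"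
      have "(?u, q) \<in> patterns W X \<times> {1..k}"
        using shift_in[OF c(2)] c(3) by (auto simp: patterns_def)
      then have "snd (product s (rep ?u, q, 0)) = snd (product s' (rep ?u, q, 0))"
        using fun_cong[OF eq, of "(?u, q)"] by (simp add: \<phi>_def)
      then have "run (rep ?u) s (q, 0) = run (rep ?u) s' (q, 0)"
        using product_apply[OF s(1) rep(1) c(3)] product_apply[OF s(2) rep(1) c(3)] shift_in[OF c(2)]
        by simp
      then show "product s c = product s' c"
        using run_rep[OF c(2,3) s(1), of i] run_rep[OF c(2,3) s(2), of i]
          product_apply[OF s(1) c(2,3)] product_apply[OF s(2) c(2,3)] by (simp add: c)
    qed
  qed
  moreover have "\<phi> ` product ` {s. set s \<subseteq> set ws} \<subseteq> (patterns W X \<times> {1..k}) \<rightarrow>\<^sub>E ({1..k} \<times> {- int N..int N})"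
  proof (intro image_subsetI)
    fix T assume "T \<in> product ` {s. set s \<subseteq> set ws}"
    then obtain s where s: "set s \<subseteq> set ws" and T: "T = product s" by blast
    have "snd (product s (rep u, q, 0)) \<in> {1..k} \<times> {- int N..int N}"
      if "u \<in> patterns W X" "q \<in> {1..k}" for u q
    proof -
      have y: "rep u \<in> X" using that rep by (auto simp: patterns_def)
      have "fst (run (rep u) s (q, 0)) \<in> {1..k}" "\<bar>snd (run (rep u) s (q, 0))\<bar> \<le> int N"
        using run_in[OF s y that(2)] bound[OF y that(2) s] by auto
      then show ?thesis using product_apply[OF s y that(2), of 0]
        by (cases "run (rep u) s (q, 0)") auto
    qed
    then show "\<phi> T \<in> (patterns W X \<times> {1..k}) \<rightarrow>\<^sub>E ({1..k} \<times> {- int N..int N})"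
      unfolding \<phi>_def T restrict_PiE_iff by auto
  qed
  moreover have "finite ((patterns W X \<times> {1..k}) \<rightarrow>\<^sub>E ({1..k} \<times> {- int N..int N}))"
  proof -
    have "patterns W X \<subseteq> PiE W (\<lambda>_. UNIV)"
      by (auto simp: patterns_def)
    then have "finite (patterns W X)"
      by (rule finite_subset) (simp add: W_def finite_PiE)
    then show ?thesis by (intro finite_PiE) auto
  qed
  ultimately show ?thesis
    by (meson finite_imageD finite_subset)
qed

text \<open>Only products without inverses have been considered. This is enough, since a finite submonoid of a
  group is a subgroup: left multiplication by \<open>a\<close> permutes it, so \<open>a\<close> has a right inverse in it.\<close>

lemma generate_subset_products:
  assumes fin: "finite (product ` {s. set s \<subseteq> set ws})"
  shows "generate G (word_value X k ` set ws) \<subseteq> product ` {s. set s \<subseteq> set ws}"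
proof
  let ?M = "product ` {s. set s \<subseteq> set ws}"
  have M: "?M \<subseteq> carrier G" using product_in by auto
  have closed: "a \<otimes>\<^bsub>G\<^esub> b \<in> ?M" if "a \<in> ?M" "b \<in> ?M" for a b
  proof -
    from that obtain s s' where "set s \<subseteq> set ws" "set s' \<subseteq> set ws" "a = product s" "b = product s'"
      by auto
    then show ?thesis by (intro image_eqI[of _ _ "s @ s'"]) (auto simp: product_append)
  qed
  have one: "\<one>\<^bsub>G\<^esub> \<in> ?M"
    by (intro image_eqI[of _ _ "[]"]) auto
  have gen: "word_value X k w \<in> ?M" if "w \<in> set ws" for w
    using that by (intro image_eqI[of _ _ "[w]"]) auto
  have inv: "inv\<^bsub>G\<^esub> a \<in> ?M" if a: "a \<in> ?M" for a
  proof -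
    have aG: "a \<in> carrier G" using M a by blast
    then have "inj_on (\<lambda>b. a \<otimes>\<^bsub>G\<^esub> b) ?M"
      using M by (intro inj_onI) (simp add: subset_iff)
    moreover have "(\<lambda>b. a \<otimes>\<^bsub>G\<^esub> b) ` ?M \<subseteq> ?M"
      using closed a by auto
    ultimately have "(\<lambda>b. a \<otimes>\<^bsub>G\<^esub> b) ` ?M = ?M"
      using fin by (intro endo_inj_surj)
    then have "\<one>\<^bsub>G\<^esub> \<in> (\<lambda>b. a \<otimes>\<^bsub>G\<^esub> b) ` ?M"
      using one by simp
    then obtain b where b: "b \<in> ?M" "\<one>\<^bsub>G\<^esub> = a \<otimes>\<^bsub>G\<^esub> b"
      by (rule imageE)
    have bG: "b \<in> carrier G" using M b(1) by blast
    have "inv\<^bsub>G\<^esub> a = b"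
      by (rule inv_equality[OF inv_comm[OF b(2)[symmetric] aG bG] aG bG])
    then show ?thesis using b by simp
  qed
  fix a assume "a \<in> generate G (word_value X k ` set ws)"
  then show "a \<in> ?M"
    by induction (use one gen inv closed in auto)
qed

lemma local_dynamics_rfa_step:
  assumes "finite Z" "\<And>x j. followers X x j \<in> Z"
  shows "local_dynamics X k radius (rfa_step k ws) (followers X) Z"
proof
  fix x q i q' i' assume "x \<in> X" "rfa_step k ws x (q, i) (q', i')"
  then obtain w where "w \<in> set ws" "q \<in> {1..k}" "(q', i') = word_step x w (q, i)"
    by (auto simp: rfa_step_def)
  then show "q' \<in> {1..k} \<and> \<bar>i' - i\<bar> \<le> int radius"
    using word_step_in[of w x q i] \<open>x \<in> X\<close> by (metis fst_conv snd_conv)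
next
  fix x y j i q q' i'
  assume *: "x \<in> X" "y \<in> X" "\<And>t. \<bar>t\<bar> \<le> int radius \<Longrightarrow> y (j + t) = x (i + t)"
    "rfa_step k ws x (q, i) (q', i')"
  then obtain w where w: "w \<in> set ws" "q \<in> {1..k}" "(q', i') = word_step x w (q, i)"
    by (auto simp: rfa_step_def)
  have "word_step y w (q, j) = (q', i' + (j - i))"
    using word_step_shifted[OF w(1) *(1) w(2) *(3)] w(3) by (metis fst_conv snd_conv)
  then show "rfa_step k ws y (q, j) (q', i' + (j - i))"
    using w by (auto simp: rfa_step_def intro!: bexI[of _ w])
qed (use assms shift_in glue_in_subshift[OF X] in auto)

lemma finite_iff_displacement_le:
  fixes Z :: "'a list set set"
  assumes Z: "finite Z" "\<And>x j. followers X x j \<in> Z"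
  defines "N \<equiv> displacement_bound (card Z) (card (UNIV :: 'a set)) k radius"
  shows "finite (generate G (word_value X k ` set ws)) \<longleftrightarrow>
    (\<forall>x\<in>X. \<forall>q\<in>{1..k}. \<forall>s. set s \<subseteq> set ws \<longrightarrow> \<bar>snd (run x s (q, 0))\<bar> \<le> int N)"
proof
  assume "finite (generate G (word_value X k ` set ws))"
  then obtain D where D: "\<And>x q s. x \<in> X \<Longrightarrow> q \<in> {1..k} \<Longrightarrow> set s \<subseteq> set ws \<Longrightarrow>
      \<bar>snd (run x s (q, 0))\<bar> \<le> D"
    using bounded_if_finite by blast
  interpret local_dynamics X k radius "rfa_step k ws" "followers X" Z
    by (rule local_dynamics_rfa_step[OF Z])
  have "\<bar>i\<bar> \<le> max D 0" if x: "x \<in> X" and reach: "(rfa_step k ws x)\<^sup>*\<^sup>* (q, 0) (q', i)" for x q q' i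
  proof (cases "q \<in> {1..k}")
    case True
    obtain s where "set s \<subseteq> set ws" "(q', i) = run x s (q, 0)"
      using reach_run[OF x reach] by blast
    then have "snd (run x s (q, 0)) = i" by (metis snd_conv)
    then show ?thesis using D[OF x True \<open>set s \<subseteq> set ws\<close>] by simp
  next
    case False
    from reach have "i = 0"
    proof (rule converse_rtranclpE)
      fix v assume "rfa_step k ws x (q, 0) v"
      then show "i = 0" using False by (simp add: rfa_step_def)
    qed simp
    then show ?thesis by simp
  qed
  note bounded = this
  show "\<forall>x\<in>X. \<forall>q\<in>{1..k}. \<forall>s. set s \<subseteq> set ws \<longrightarrow> \<bar>snd (run x s (q, 0))\<bar> \<le> int N"
  proof (intro ballI allI impI)
    fix x q s assume x: "x \<in> X" and "q \<in> {1..k}" "set s \<subseteq> set ws"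
    then have "(rfa_step k ws x)\<^sup>*\<^sup>* (q, 0) (fst (run x s (q, 0)), snd (run x s (q, 0)))"
      using run_reach[of x q s 0] by simp
    from displacement_le[OF bounded x this] show "\<bar>snd (run x s (q, 0))\<bar> \<le> int N"
      unfolding N_def .
  qed
next
  assume "\<forall>x\<in>X. \<forall>q\<in>{1..k}. \<forall>s. set s \<subseteq> set ws \<longrightarrow> \<bar>snd (run x s (q, 0))\<bar> \<le> int N"
  then have "finite (product ` {s. set s \<subseteq> set ws})"
    by (intro finite_products[of N]) auto
  then show "finite (generate G (word_value X k ` set ws))"
    using generate_subset_products finite_subset by blast
qed

text \<open>A trajectory that leaves \<open>[-N, N]\<close> may be stopped as soon as it does so, and repetitions may be
  removed. What remains is a path in the finite graph of the steps that start inside the interval,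
  and it needs no more steps than that graph has edges.\<close>

lemma short_run:
  assumes x: "x \<in> X" and q: "q \<in> {1..k}" and s: "set s \<subseteq> set ws"
    and far: "int N < \<bar>snd (run x s (q, 0))\<bar>"
  shows "\<exists>s. set s \<subseteq> set ws \<and> length s \<le> k * (2 * N + 1) * (k * (2 * (N + radius) + 1)) \<and>
    int N < \<bar>snd (run x s (q, 0))\<bar>"
proof -
  define R where "R = {(u, v). rfa_step k ws x u v \<and> \<bar>snd u\<bar> \<le> int N}"
  let ?A = "{1..k} \<times> {- int N..int N}" and ?B = "{1..k} \<times> {- int (N + radius)..int (N + radius)}"
  have sub: "R \<subseteq> ?A \<times> ?B"
  proof
    fix e assume "e \<in> R"
    moreover obtain q i q' i' where e: "e = ((q, i), (q', i'))" by (metis surj_pair)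
    ultimately obtain w where w: "w \<in> set ws" "q \<in> {1..k}" "(q', i') = word_step x w (q, i)" and i: "\<bar>i\<bar> \<le> int N"
      by (auto simp: R_def rfa_step_def)
    have "q' \<in> {1..k}" "\<bar>i' - i\<bar> \<le> int radius"
      using word_step_in[OF w(1) x w(2), of i] w(3) by (metis fst_conv snd_conv)+
    then show "e \<in> ?A \<times> ?B"
      using w(2) i by (auto simp: e)
  qed
  have sz: "card ({1..k} \<times> {- int m..int m}) = k * (2 * m + 1)" for m
  proof -
    have "nat (int m - - int m + 1) = 2 * m + 1" by simp
    then show ?thesis by (simp add: card_cartesian_product)
  qed
  have fin: "finite R"
    by (rule finite_subset[OF sub]) simp
  have "card R \<le> card (?A \<times> ?B)"
    by (rule card_mono[OF _ sub]) simp
  then have card: "card R \<le> k * (2 * N + 1) * (k * (2 * (N + radius) + 1))"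
    unfolding card_cartesian_product[of ?A] sz .
  \<comment> \<open>Either the whole trajectory uses only edges of \<open>R\<close>, or it has a first point outside the interval,
    which is reached through \<open>R\<close>.\<close>
  have "(((q, 0), v) \<in> R\<^sup>*) \<or> (\<exists>v'. ((q, 0), v') \<in> R\<^sup>* \<and> int N < \<bar>snd v'\<bar>)"
    if "(rfa_step k ws x)\<^sup>*\<^sup>* (q, 0) v" for v
    using that
  proof induction
    case (step v v')
    show ?case
    proof (cases "((q, 0), v) \<in> R\<^sup>* \<and> \<bar>snd v\<bar> \<le> int N")
      case True
      then have "((q, 0), v') \<in> R\<^sup>*"
        using step.hyps(2) by (auto simp: R_def intro: rtrancl_into_rtrancl)
      then show ?thesis by blast
    next
      case False
      then show ?thesis using step.IH by (metis not_le)
    qed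
  qed simp
  from this[OF run_reach[OF x q s, of 0]] obtain v where v: "((q, 0), v) \<in> R\<^sup>*" "int N < \<bar>snd v\<bar>"
    using far by blast
  then obtain n where n: "n \<le> card R" "((q, 0), v) \<in> R ^^ n"
    using rtrancl_finite_eq_relpow[OF fin] by auto
  have "\<exists>s. set s \<subseteq> set ws \<and> length s = n \<and> v = run x s (q, 0)"
    using n(2)
  proof (induction n arbitrary: v)
    case 0
    then show ?case by auto
  next
    case (Suc n)
    then obtain u where u: "((q, 0), u) \<in> R ^^ n" "(u, v) \<in> R" by auto
    then obtain s w where "set s \<subseteq> set ws" "length s = n" "u = run x s (q, 0)"
        "w \<in> set ws" "v = word_step x w u"
      using Suc.IH[OF u(1)] by (auto simp: R_def rfa_step_def)
    then show ?case by (intro exI[of _ "w # s"]) auto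
  qed
  then obtain s where "set s \<subseteq> set ws" "length s = n" "v = run x s (q, 0)" by blast
  then show ?thesis using n(1) card v(2) by (intro exI[of _ s]) simp
qed

end


section \<open>The decision procedure\<close>

lemma computable_finite_member [computable_intros]:
  "finite A \<Longrightarrow> computable f \<Longrightarrow> computable (\<lambda>x. f x \<in> A)"
proof (induction rule: finite_induct)
  case empty
  show ?case by (simp add: computable_const)
next
  case (insert a A)
  then have "computable (\<lambda>x. f x = a \<or> f x \<in> A)"
    by (intro computable_intros) auto
  then show ?case by simp
qed

text \<open>In the code of an integer, the parity gives the sign and half of the code gives the absolute value
  (of \<open>i + 1\<close> for negative \<open>i\<close>), so the sum is found by halving.\<close>

lemma computable_nat_add_int [computable_intros]:
  assumes f: "computable f" and g: "computable g"
  shows "computable (\<lambda>x. nat (int (f x) + g x))"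
proof -
  \<comment> \<open>Halving and parity are computed together, by a recursion that alternates between both parities.\<close>
  define halve where "halve n = rec_nat (0::nat, False) (\<lambda>_ s. if snd s then (Suc (fst s), False) else (fst s, True)) n" for n
  have halve: "halve n = (n div 2, odd n)" for n
    by (induction n) (auto simp: halve_def)
  have h: "computable h \<Longrightarrow> computable (\<lambda>x. halve (h x))" for h :: "'a \<Rightarrow> nat"
    unfolding halve_def by (intro computable_intros)
  have "computable (\<lambda>x. if snd (halve (encode (g x))) then f x - Suc (fst (halve (encode (g x))))
      else f x + fst (halve (encode (g x))))"
    by (intro computable_intros h f g)
  moreover have "(if snd (halve (encode i)) then n - Suc (fst (halve (encode i)))
      else n + fst (halve (encode i))) = nat (int n + i)" for n i
    by (auto simp: halve int_encode_def sum_encode_def)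
  ultimately show ?thesis by simp
qed

definition assoc :: "'v \<Rightarrow> ('k \<times> 'v) list \<Rightarrow> 'k \<Rightarrow> 'v" where
  "assoc d t key = foldr (\<lambda>e v. if fst e = key then snd e else v) t d"

lemma assoc_map_of: "map_of t key = Some v \<Longrightarrow> assoc d t key = v"
  unfolding assoc_def by (induction t) (auto split: if_splits)

lemma computable_assoc [computable_intros]:
  assumes "computable d" "computable t" "computable key"
  shows "computable (\<lambda>x. assoc (d x) (t x) (key x))"
  unfolding assoc_def by (intro computable_intros assms computable_compose[OF assms(3), of fst])

text \<open>The tape is replaced by a finite word, and head positions by indices into it. The value of
  \<^term>\<open>hd (drop n xs)\<close> for too large \<open>n\<close> does not depend on \<open>n\<close>, in contrast to that of
  \<^term>\<open>xs ! n\<close>; this makes it a computable expression for all arguments.\<close>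

definition tape_entry :: "nat list \<Rightarrow> nat table \<Rightarrow> nat \<times> nat \<Rightarrow> nat \<times> int" where
  "tape_entry u p c =
     assoc (0, 0) (snd p) (map (\<lambda>f. hd (drop (nat (int (snd c) + f)) u)) (fst p), fst c)"

definition tape_step :: "nat list \<Rightarrow> nat table \<Rightarrow> nat \<times> nat \<Rightarrow> nat \<times> nat" where
  "tape_step u p c = (fst (tape_entry u p c), nat (int (snd c) + snd (tape_entry u p c)))"

text \<open>A sequence of generators is given by their indices in the input.\<close>

definition tape_run :: "nat list \<Rightarrow> nat table list list \<Rightarrow> nat list \<Rightarrow> nat \<times> nat \<Rightarrow> nat \<times> nat" where
  "tape_run u vs s = foldr (\<lambda>n. foldr (tape_step u) (hd (drop n vs))) s"

lemma computable_tape_entry [computable_intros]: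
  assumes "computable u" "computable p" "computable c"
  shows "computable (\<lambda>x. tape_entry (u x) (p x) (c x))"
  unfolding tape_entry_def
  by (intro computable_intros assms computable_compose[OF assms(1), of fst] computable_compose[OF assms(3), of fst])

lemma computable_tape_step [computable_intros]:
  assumes "computable u" "computable p" "computable c"
  shows "computable (\<lambda>x. tape_step (u x) (p x) (c x))"
  unfolding tape_step_def by (intro computable_intros assms)

lemma computable_tape_run [computable_intros]:
  assumes u: "computable u" and "computable vs" "computable s" "computable c"
  shows "computable (\<lambda>x. tape_run (u x) (vs x) (s x) (c x))"
  unfolding tape_run_def
  by (intro computable_intros assms computable_compose[OF assms(2), of fst]
     computable_compose[OF u, of "\<lambda>z. fst (fst z)"])

text \<open>A bound for the codes of all lists of length at most \<open>n\<close> with entries at most \<open>a\<close>. It turns the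
  search for such a list into a bounded search for a number.\<close>

definition code_bound :: "nat \<Rightarrow> nat \<Rightarrow> nat" where
  "code_bound a n = rec_nat 0 (\<lambda>_ b. Suc (encode (a, b))) n"

lemma computable_code_bound [computable_intros]:
  assumes "computable a" "computable n"
  shows "computable (\<lambda>x. code_bound (a x) (n x))"
  unfolding code_bound_def by (intro computable_intros assms computable_compose[OF assms(1), of fst])

lemma prod_encode_mono:
  assumes "a \<le> a'" "b \<le> b'"
  shows "prod_encode (a, b) \<le> prod_encode (a', b')"
proof -
  have "triangle (a + b) \<le> triangle (a' + b')"
    using assms by (intro triangle_mono add_mono)
  then show ?thesis
    using assms by (simp add: prod_encode_def)
qed

lemma list_encode_le_code_bound:
  "length xs \<le> n \<Longrightarrow> \<forall>x\<in>set xs. x \<le> a \<Longrightarrow> list_encode xs \<le> code_bound a n"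
proof (induction xs arbitrary: n)
  case (Cons x xs)
  then obtain m where n: "n = Suc m" by (cases n) auto
  then show ?case
    using Cons prod_encode_mono[of x a "list_encode xs" "code_bound a m"] by (simp add: code_bound_def)
qed (simp add: code_bound_def)

definition rename :: "('a \<Rightarrow> nat) \<Rightarrow> 'a table \<Rightarrow> nat table" where
  "rename enc p = (fst p, map (\<lambda>e. ((map enc (fst (fst e)), snd (fst e)), snd e)) (snd p))"

lemma encode_rename: "encode (rename enc p) = encode_table enc p"
proof -
  obtain Fs t where p: "p = (Fs, t)" by fastforce
  have "encode ((map enc (fst (fst e)), snd (fst e)), snd e) = encode_entry enc e" for e
  proof -
    obtain u q q' m where "e = ((u, q), (q', m))" by (metis surj_pair)
    then show ?thesis by (simp add: encode_list_def comp_def)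
  qed
  moreover have "(encode :: int \<Rightarrow> nat) = int_encode" by (rule ext) simp
  ultimately show ?thesis
    by (simp add: p rename_def encode_list_def comp_def)
qed

lemma encode_map_rename: "encode (map (map (rename enc)) ws) = encode_words enc ws"
  by (simp only: encode_words_def encode_list_def map_map comp_def encode_rename)

lemma map_of_rename:
  assumes "inj enc"
  shows "map_of (snd (rename enc (Fs, t))) (map enc u, q) = map_of t (u, q)"
  using assms unfolding rename_def by (induction t) auto

context RFA_words
begin

lemma tape_step_simulates:
  assumes enc: "inj enc" and p: "presents_RFA_element X k p" and x: "x \<in> X" and q: "q \<in> {1..k}"
    and i: "\<bar>i\<bar> + int (encode_table enc p) \<le> int R"
  shows "tape_step (map (\<lambda>j. enc (x j)) [- int R..int R]) (rename enc p) (q, nat (i + int R)) =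
    (fst (table_step x p (q, i)), nat (snd (table_step x p (q, i)) + int R))"
proof -
  obtain Fs t where p_eq: "p = (Fs, t)" by fastforce
  let ?u = "map (\<lambda>j. enc (x j)) [- int R..int R]"
  have "hd (drop (nat (int (nat (i + int R)) + f)) ?u) = enc (x (i + f))" if "f \<in> set Fs" for f
  proof -
    have f: "\<bar>f\<bar> \<le> int (encode_table enc p)"
      unfolding p_eq using that by (rule window_le_encode_table)
    then have "hd (drop (nat (i + f + int R)) ?u) = ?u ! nat (i + f + int R)"
      using i by (intro hd_drop_conv_nth) auto
    also have "\<dots> = enc (x (i + f))"
    proof -
      have "int (nat (i + f + int R)) = i + f + int R" using i f by simp
      moreover have "nat (i + f + int R) < length [- int R..int R]" using i f by auto
      moreover have "i + f \<le> int R" using i f by simp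
      ultimately show ?thesis by (simp add: nth_upto)
    qed
    also have "i + f + int R = int (nat (i + int R)) + f"
      using i by simp
    finally show ?thesis .
  qed
  then have read: "map (\<lambda>f. hd (drop (nat (int (nat (i + int R)) + f)) ?u)) Fs = map enc (map (\<lambda>f. x (i + f)) Fs)"
    by simp
  have wf: "table_wf X k (Fs, t)"
    using p by (simp add: p_eq presents_RFA_element_def)
  have "(map (\<lambda>j. x (i + j)) Fs, q) = (map (shift (- i) x) Fs, q)"
    by (simp add: shift_def add.commute)
  then have "(map (\<lambda>f. x (i + f)) Fs, q) \<in> {(map x Fs, q) | x q. x \<in> X \<and> q \<in> {1..k}}"
    using shift_in[OF x, of "- i"] q by blast
  then have "(map (\<lambda>f. x (i + f)) Fs, q) \<in> dom (map_of t)"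
    using wf by (simp only: table_wf.simps)
  then obtain v where v: "map_of t (map (\<lambda>f. x (i + f)) Fs, q) = Some v"
    by blast
  have "assoc (0, 0) (snd (rename enc p)) (map enc (map (\<lambda>f. x (i + f)) Fs), q) = v"
    by (rule assoc_map_of) (simp only: p_eq map_of_rename[OF enc] v)
  then have "tape_entry ?u (rename enc p) (q, nat (i + int R)) = v"
    unfolding tape_entry_def fst_conv snd_conv by (simp only: p_eq rename_def fst_conv read)
  moreover have "table_step x p (q, i) = (fst v, i + snd v)"
    by (simp add: p_eq v)
  ultimately show ?thesis
    using i by (simp add: tape_step_def algebra_simps)
qed

lemma tape_word_simulates:
  assumes enc: "inj enc" and w: "\<forall>p\<in>set w. presents_RFA_element X k p" and x: "x \<in> X" and q: "q \<in> {1..k}"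
    and i: "\<bar>i\<bar> + int (encode_word enc w) \<le> int R"
  shows "foldr (tape_step (map (\<lambda>j. enc (x j)) [- int R..int R])) (map (rename enc) w) (q, nat (i + int R)) =
    (fst (word_step x w (q, i)), nat (snd (word_step x w (q, i)) + int R))"
  using w i
proof (induction w)
  case (Cons p w)
  obtain q1 i1 where c: "word_step x w (q, i) = (q1, i1)" by fastforce
  have code: "int (encode_table enc p) + int (encode_word enc w) \<le> int (encode_word enc (p # w))"
    using encode_word_Cons[of enc p w] by linarith
  have 1: "q1 \<in> {1..k}" "\<bar>i1 - i\<bar> \<le> int (encode_word enc w)"
    using word_step_range[of w X k x q i enc] Cons.prems c shift_in[OF x] q
    by (auto simp: presents_RFA_element_def)
  have "tape_step (map (\<lambda>j. enc (x j)) [- int R..int R]) (rename enc p) (q1, nat (i1 + int R)) =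
      (fst (table_step x p (q1, i1)), nat (snd (table_step x p (q1, i1)) + int R))"
  proof (rule tape_step_simulates[OF enc _ x 1(1)])
    show "presents_RFA_element X k p" using Cons.prems by simp
    show "\<bar>i1\<bar> + int (encode_table enc p) \<le> int R"
      using code 1(2) Cons.prems(2) by linarith
  qed
  moreover have "\<bar>i\<bar> + int (encode_word enc w) \<le> int R"
    using code Cons.prems(2) by linarith
  ultimately show ?case using Cons c by simp
qed simp

text \<open>Each generator moves the head by at most \<open>radius\<close> and reads no further than that. A window that
  extends \<open>length ns * radius\<close> cells to both sides of the origin is therefore never left, and index \<open>R\<close>
  of the word stands for position \<open>0\<close>.\<close>

lemma tape_run_simulates:
  assumes enc: "inj enc" and x: "x \<in> X" and q: "q \<in> {1..k}"
    and ns: "\<forall>n\<in>set ns. n < length ws" and R: "length ns * radius \<le> R"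
  defines "s \<equiv> map ((!) ws) ns"
  shows "tape_run (map (\<lambda>j. enc (x j)) [- int R..int R]) (map (map (rename enc)) ws) ns (q, R) =
      (fst (run x s (q, 0)), nat (snd (run x s (q, 0)) + int R)) \<and>
    \<bar>snd (run x s (q, 0))\<bar> \<le> int (length ns * radius)"
  using ns R unfolding s_def
proof (induction ns)
  case Nil
  then show ?case by (simp add: tape_run_def)
next
  case (Cons n ns)
  let ?s = "map ((!) ws) ns"
  obtain q1 i1 where c: "run x ?s (q, 0) = (q1, i1)" by fastforce
  have n: "ws ! n \<in> set ws" "n < length ws" and R: "length ns * radius + radius \<le> R"
    using Cons.prems by auto
  have IH: "tape_run (map (\<lambda>j. enc (x j)) [- int R..int R]) (map (map (rename enc)) ws) ns (q, R) =
      (q1, nat (i1 + int R))" "\<bar>i1\<bar> \<le> int (length ns * radius)"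
    using Cons c by auto
  have "set ?s \<subseteq> set ws" using Cons.prems by auto
  from run_in[OF this x q, of 0] have q1: "q1 \<in> {1..k}" using c by simp
  have step: "\<bar>snd (word_step x (ws ! n) (q1, i1)) - i1\<bar> \<le> int radius"
    by (rule word_step_in(2)[OF n(1) x q1])
  have "foldr (tape_step (map (\<lambda>j. enc (x j)) [- int R..int R])) (map (rename enc) (ws ! n)) (q1, nat (i1 + int R)) =
      (fst (word_step x (ws ! n) (q1, i1)), nat (snd (word_step x (ws ! n) (q1, i1)) + int R))"
  proof (rule tape_word_simulates[OF enc _ x q1])
    show "\<forall>p\<in>set (ws ! n). presents_RFA_element X k p" using valid n by blast
    have "int (encode_word enc (ws ! n)) \<le> int radius" using encode_word_le[OF n(1), of enc] by simp
    then show "\<bar>i1\<bar> + int (encode_word enc (ws ! n)) \<le> int R" using IH(2) R by linarith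
  qed
  moreover have "hd (drop n (map (map (rename enc)) ws)) = map (rename enc) (ws ! n)"
    using n by (simp add: hd_drop_conv_nth)
  ultimately have "tape_run (map (\<lambda>j. enc (x j)) [- int R..int R]) (map (map (rename enc)) ws) (n # ns) (q, R) =
      (fst (word_step x (ws ! n) (q1, i1)), nat (snd (word_step x (ws ! n) (q1, i1)) + int R))"
    using IH(1) by (simp add: tape_run_def)
  moreover have "\<bar>snd (word_step x (ws ! n) (q1, i1))\<bar> \<le> int (length ns * radius) + int radius"
    using step IH(2) by linarith
  ultimately show ?case using c by simp
qed

end

text \<open>The automaton is part of the program. The letters have to be checked separately, since its
  transitions are only given for numbers of letters.\<close>

lemma computable_language:
  assumes "regular (language X)" and enc: "inj (enc :: 'a::finite \<Rightarrow> nat)"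
  shows "computable (\<lambda>u. u \<in> map enc ` language X)"
proof -
  obtain S :: "nat set" and s0 A \<delta> where S: "finite S" "s0 \<in> S" "A \<subseteq> S" "\<forall>s\<in>S. \<forall>a. \<delta> s a \<in> S"
    and L: "language X = {w. foldl \<delta> s0 w \<in> A}"
    using assms(1) unfolding regular_def by blast
  obtain g where g: "computable g" "\<forall>z\<in>S \<times> range enc. g z = \<delta> (fst z) (inv_into UNIV enc (snd z))"
    using finite_imp_computable_on[of "S \<times> range enc" "\<lambda>z. \<delta> (fst z) (inv_into UNIV enc (snd z))"] S(1) by auto
  have g_fold: "foldl (\<lambda>s a. g (s, a)) s (map enc w) = foldl \<delta> s w" if "s \<in> S" for s w
    using that
  proof (induction w arbitrary: s)
    case (Cons a w)
    then show ?case using g(2) S(4) enc by simp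
  qed simp
  have letters: "foldr (\<lambda>a b. a \<in> range enc \<and> b) u True \<longleftrightarrow> set u \<subseteq> range enc" for u
    by (induction u) auto
  have finA: "finite A" using S by (auto intro: finite_subset)
  have "computable (\<lambda>u. foldr (\<lambda>a b. a \<in> range enc \<and> b) u True \<and> foldl (\<lambda>s a. g (s, a)) s0 u \<in> A)"
    by (intro computable_intros finA computable_compose[OF g(1)]) simp
  moreover have "(foldr (\<lambda>a b. a \<in> range enc \<and> b) u True \<and> foldl (\<lambda>s a. g (s, a)) s0 u \<in> A) \<longleftrightarrow>
      u \<in> map enc ` language X" for u
  proof (cases "set u \<subseteq> range enc")
    case True
    then obtain w where w: "u = map enc w" by (metis ex_map_conv image_iff subset_iff)
    moreover have "u \<in> map enc ` language X \<longleftrightarrow> w \<in> language X"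
      using enc by (auto simp: w inj_map_eq_map)
    ultimately show ?thesis
      using True g_fold[OF S(2)] unfolding letters by (simp add: L)
  next
    case False
    then show ?thesis unfolding letters by auto
  qed
  ultimately show ?thesis by simp
qed

text \<open>On the tape segment \<open>u\<close>, the generators with the indices \<open>ns\<close> take the head from the middle of the
  segment, in state \<open>q\<close>, further than \<open>N\<close> cells away.\<close>

definition escape_witness ::
    "nat list set \<Rightarrow> nat \<Rightarrow> nat \<Rightarrow> nat \<Rightarrow> nat table list list \<Rightarrow> nat list \<Rightarrow> nat \<Rightarrow> nat list \<Rightarrow> bool" where
  "escape_witness L N l R vs u q ns \<longleftrightarrow>
     u \<in> L \<and> length u = 2 * R + 1 \<and> 0 < q \<and>
     length ns \<le> l \<and> foldr (\<lambda>n b. n < length vs \<and> b) ns True \<and>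
     (R + N < snd (tape_run u vs ns (q, R)) \<or> snd (tape_run u vs ns (q, R)) + N < R)"

definition escapes :: "nat list set \<Rightarrow> nat \<Rightarrow> nat \<Rightarrow> nat \<Rightarrow> nat \<Rightarrow> nat \<Rightarrow> nat table list list \<Rightarrow> bool" where
  "escapes L a k N l R vs \<longleftrightarrow>
     (\<exists>uc < Suc (code_bound a (2 * R + 1)). \<exists>q < Suc k. \<exists>sc < Suc (code_bound (length vs) l).
        escape_witness L N l R vs (list_decode uc) q (list_decode sc))"

lemma computable_escapes [computable_intros]:
  assumes L: "computable (\<lambda>u. u \<in> L)" and N: "computable N" and l: "computable l" and R: "computable R"
    and vs: "computable vs"
  shows "computable (\<lambda>x. escapes L a k (N x) (l x) (R x) (vs x))"
  unfolding escapes_def escape_witness_def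
  by (intro computable_intros assms computable_compose[OF L]
    computable_compose[OF l, of fst] computable_compose[OF vs, of fst]
    computable_compose[OF l, of "\<lambda>z. fst (fst z)"] computable_compose[OF vs, of "\<lambda>z. fst (fst z)"]
    computable_compose[OF R, of "\<lambda>z. fst (fst (fst z))"] computable_compose[OF N, of "\<lambda>z. fst (fst (fst z))"]
    computable_compose[OF l, of "\<lambda>z. fst (fst (fst z))"] computable_compose[OF vs, of "\<lambda>z. fst (fst (fst z))"]
    computable_compose[OF vs, of "\<lambda>z. fst (fst (fst (fst z)))"])

lemma (in RFA_words) escapes_iff:
  assumes enc: "inj enc" and l: "l * radius \<le> R" and a: "\<forall>b. enc b \<le> a"
  shows "escapes (map enc ` language X) a k N l R (map (map (rename enc)) ws) \<longleftrightarrow>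
    (\<exists>x\<in>X. \<exists>q\<in>{1..k}. \<exists>s. set s \<subseteq> set ws \<and> length s \<le> l \<and> int N < \<bar>snd (run x s (q, 0))\<bar>)"
proof -
  have all: "foldr (\<lambda>n b. n < m \<and> b) ns True \<longleftrightarrow> (\<forall>n\<in>set ns. n < m)" for ns and m :: nat
    by (induction ns) auto
  have wit: "escape_witness (map enc ` language X) N l R (map (map (rename enc)) ws)
        (map (\<lambda>j. enc (x j)) [- int R..int R]) q ns \<longleftrightarrow>
      length ns \<le> l \<and> (\<forall>n\<in>set ns. n < length ws) \<and> int N < \<bar>snd (run x (map ((!) ws) ns) (q, 0))\<bar>"
    if x: "x \<in> X" and q: "q \<in> {1..k}" for x q ns
  proof (cases "length ns \<le> l \<and> (\<forall>n\<in>set ns. n < length ws)")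
    case True
    have R: "length ns * radius \<le> R"
      using mult_le_mono1[of "length ns" l] True l by (blast intro: order_trans)
    define p where "p = snd (run x (map ((!) ws) ns) (q, 0))"
    have "int (length ns * radius) \<le> int R" using R by (simp only: of_nat_le_iff)
    then have p: "\<bar>p\<bar> \<le> int R" and
      "snd (tape_run (map (\<lambda>j. enc (x j)) [- int R..int R]) (map (map (rename enc)) ws) ns (q, R)) = nat (p + int R)"
      using tape_run_simulates[OF enc x q _ R] True unfolding p_def by (linarith, simp)
    moreover have "R + N < nat (p + int R) \<or> nat (p + int R) + N < R \<longleftrightarrow> int N < \<bar>p\<bar>"
      using p by linarith
    moreover have "map (\<lambda>j. enc (x j)) [- int R..int R] \<in> map enc ` language X"
    proof (rule image_eqI)
      show "map x [- int R..int R] \<in> language X"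
        using x by (auto simp: language_def)
    qed simp
    ultimately show ?thesis
      using True q unfolding escape_witness_def all p_def[symmetric] by auto
  next
    case False
    then show ?thesis unfolding escape_witness_def all length_map by blast
  qed
  show ?thesis
  proof
    assume "escapes (map enc ` language X) a k N l R (map (map (rename enc)) ws)"
    then obtain uc q ns where q: "q < Suc k" and
      esc: "escape_witness (map enc ` language X) N l R (map (map (rename enc)) ws) (list_decode uc) q ns"
      unfolding escapes_def by blast
    then have q: "q \<in> {1..k}"
      by (simp add: escape_witness_def)
    obtain w where w: "w \<in> language X" "list_decode uc = map enc w" "length w = 2 * R + 1"
      using esc unfolding escape_witness_def by (metis imageE length_map)
    obtain x where x: "x \<in> X" "map x [- int R..int R] = w"
      by (rule language_windowE[OF X w(1), of "int R" "- int R"]) (use w in auto)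
    then have u: "list_decode uc = map (\<lambda>j. enc (x j)) [- int R..int R]"
      using w by auto
    have "length ns \<le> l" "\<forall>n\<in>set ns. n < length ws" "int N < \<bar>snd (run x (map ((!) ws) ns) (q, 0))\<bar>"
      using esc unfolding u wit[OF x(1) q] by blast+
    then show "\<exists>x\<in>X. \<exists>q\<in>{1..k}. \<exists>s. set s \<subseteq> set ws \<and> length s \<le> l \<and> int N < \<bar>snd (run x s (q, 0))\<bar>"
      using x(1) q
      by (intro bexI[of _ x] bexI[of _ q] exI[of _ "map ((!) ws) ns"] conjI) auto
  next
    assume "\<exists>x\<in>X. \<exists>q\<in>{1..k}. \<exists>s. set s \<subseteq> set ws \<and> length s \<le> l \<and> int N < \<bar>snd (run x s (q, 0))\<bar>"
    then obtain x q s where *: "x \<in> X" "q \<in> {1..k}" "set s \<subseteq> set ws" "length s \<le> l"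
      "int N < \<bar>snd (run x s (q, 0))\<bar>" by blast
    obtain ns where ns: "s = map ((!) ws) ns" "\<forall>n\<in>set ns. n < length ws"
      using *(3)
    proof (induction s arbitrary: thesis)
      case (Cons w s)
      then obtain ns where "s = map ((!) ws) ns" "\<forall>n\<in>set ns. n < length ws" by auto
      moreover obtain n where "n < length ws" "w = ws ! n"
        using Cons.prems(2) by (auto simp: in_set_conv_nth)
      ultimately show ?case using Cons.prems(1)[of "n # ns"] by auto
    qed simp
    let ?u = "map (\<lambda>j. enc (x j)) [- int R..int R]"
    have "escape_witness (map enc ` language X) N l R (map (map (rename enc)) ws)
        (list_decode (list_encode ?u)) q (list_decode (list_encode ns))"
      unfolding list_encode_inverse wit[OF *(1,2)] using *(4,5) ns by simp
    moreover have "list_encode ?u < Suc (code_bound a (2 * R + 1))"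
      using a by (intro le_imp_less_Suc list_encode_le_code_bound) auto
    moreover have "list_encode ns < Suc (code_bound (length (map (map (rename enc)) ws)) l)"
      using ns *(4) by (intro le_imp_less_Suc list_encode_le_code_bound) auto
    moreover have "q < Suc k" using *(2) by simp
    ultimately show "escapes (map enc ` language X) a k N l R (map (map (rename enc)) ws)"
      unfolding escapes_def by blast
  qed
qed

theorem theorem4p11:
  fixes X :: "(int \<Rightarrow> 'a::finite) set"
    and enc :: "'a \<Rightarrow> nat"
    and k :: nat
  assumes "sofic_subshift X"
    and "inj enc"
    and "k \<ge> 1"
  shows "\<exists>decider. \<forall>ws.
           (\<forall>w\<in>set ws. \<forall>p\<in>set w. presents_RFA_element X k p) \<longrightarrow>
           computes decider [encode_words enc ws]
             (if finite (generate (RFA X k) (word_value X k ` set ws)) then 1 else 0)"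
proof -
  have X: "subshift X" and reg: "regular (language X)"
    using assms(1) by (auto simp: sofic_subshift_def)
  obtain Z where Z: "finite Z" "\<And>x j. followers X x j \<in> Z"
    using finite_followers[OF reg] by blast
  define N where "N r = displacement_bound (card Z) (card (UNIV :: 'a set)) k r" for r
  define l where "l r = k * (2 * N r + 1) * (k * (2 * (N r + r) + 1))" for r
  define a where "a = Max (range enc)"
  have a: "\<forall>b. enc b \<le> a"
    by (auto simp: a_def)
  \<comment> \<open>The code of the input is the radius; bound, length of trajectories and window are computed from it.\<close>
  define decide :: "nat table list list \<Rightarrow> nat" where
    "decide vs = (if escapes (map enc ` language X) a k (N (encode vs)) (l (encode vs)) (l (encode vs) * encode vs) vs
       then 0 else 1)" for vs
  have "computable decide"
    unfolding decide_def[abs_def] l_def N_def displacement_bound_def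
    by (intro computable_intros computable_language[OF reg assms(2)])
  then obtain decider where decider: "\<And>vs. computes decider [encode vs] (decide vs)"
    unfolding computable_def by auto
  have "decide (map (map (rename enc)) ws) =
      (if finite (generate (RFA X k) (word_value X k ` set ws)) then 1 else 0)"
    if valid: "\<forall>w\<in>set ws. \<forall>p\<in>set w. presents_RFA_element X k p" for ws
  proof -
    interpret RFA_words X k enc ws
      using X valid by unfold_locales
    have "finite (generate (RFA X k) (word_value X k ` set ws)) \<longleftrightarrow>
        \<not> (\<exists>x\<in>X. \<exists>q\<in>{1..k}. \<exists>s. set s \<subseteq> set ws \<and> int (N radius) < \<bar>snd (run x s (q, 0))\<bar>)"
      unfolding finite_iff_displacement_le[OF Z] N_def by (meson linorder_not_le)
    also have "\<dots> \<longleftrightarrow> \<not> (\<exists>x\<in>X. \<exists>q\<in>{1..k}. \<exists>s. set s \<subseteq> set ws \<and> length s \<le> l radius \<and>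
        int (N radius) < \<bar>snd (run x s (q, 0))\<bar>)"
      unfolding l_def using short_run by blast
    also have "\<dots> \<longleftrightarrow> \<not> escapes (map enc ` language X) a k (N radius) (l radius) (l radius * radius)
        (map (map (rename enc)) ws)"
      using escapes_iff[OF assms(2) order_refl a] by simp
    finally show ?thesis
      by (simp add: decide_def encode_map_rename)
  qed
  then show ?thesis
    using decider by (intro exI[of _ decider]) (metis encode_map_rename)
qed

end
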